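(* Let $G$ be a locally compact group and, for $i=1,2$, let $\eta_i$ be an admissible vector for a unitary representation $\{\pi_i,\mathcal H_{\pi_i}\}$ of $G$. Put $g_{\eta_i}:=(\eta_i|\pi_i(\cdot)\eta_i)\in L^2(G)$, $\hat{\mathcal H}_{\eta_i}:=\langle\mathcal L_G\Delta^{-1/4}g_{\eta_i}\rangle$ and $\hat{\mathfrak P}_{\eta_i}:=\mathfrak P\cap\hat{\mathcal H}_{\eta_i}$. The following conditions are equivalent (orthogonality in $L^2(G)$): (i) $\Delta^{-1/4}g_{\eta_1}\perp\Delta^{-1/4}g_{\eta_2}$. (ii) $\hat{\mathfrak P}_{\eta_1}\perp\hat{\mathfrak P}_{\eta_2}$. (iii) $\hat{\mathcal H}_{\eta_1}\perp\hat{\mathcal H}_{\eta_2}$.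
   Context: $G$ is a locally compact group with fixed left Haar measure $ds$ and modular function $\delta_G$ (so $d(st)=\delta_G(t)\,ds$, $d(s^{-1})=\delta_G(s^{-1})\,ds$). $C_c(G)$ is the space of complex continuous compactly supported functions; $L^2(G)$ is taken with respect to $ds$. A unitary representation $\{\pi,\mathcal H_\pi\}$ is a strongly continuous homomorphism from $G$ into the unitary operators of a nonzero Hilbert space $\mathcal H_\pi$, with inner product $(\cdot|\cdot)$ linear in the first variable. With $[L_\eta\psi](s):=(\psi|\pi(s)\eta)$, the vector $\eta\in\mathcal H_\pi$ is admissible if $L_\eta$ is a bounded map $\mathcal H_\pi\to L^2(G)$ with $L_\eta^*L_\eta=I_{\mathcal H_\pi}$. The left regular representation on $L^2(G)$ is $[\lambda(s)f](t):=f(s^{-1}t)$ and $\mathcal L_G:=\{\lambda(s):s\in G\}''$. The modular operator is $[\Delta f](s):=\delta_G(s)f(s)$ (multiplication operator with maximal domain; $\Delta^\alpha$ is multiplication by $\delta_G^\alpha$ with maximal domain). For admissible $\eta$, $g_\eta:=(\eta|\pi(\cdot)\eta)$ lies in the domain of $\Delta^{-1/4}$. $\langle\cdot\rangle$ denotes closed linear span. Convolution $[f\ast g](s):=\int_G f(t)g(t^{-1}s)\,dt$; $f^\sharp(s):=\delta_G(s^{-1})\overline{f(s^{-1})}$ with domain $\mathcal D^\sharp:=\{f\in L^2(G):\int\delta_G|f|^2\,ds<\infty\}$; $f^\flat(s):=\overline{f(s^{-1})}$ with domain $\mathcal D^\flat:=\{f\in L^2(G):\int\delta_G^{-1}|f|^2\,ds<\infty\}$.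 A vector $g\in L^2(G)$ is right (resp. left) bounded if $f\mapsto f\ast g$ (resp. $f\mapsto g\ast f$) is bounded on $C_c(G)$ in the $L^2$-norm; $\mathcal B'$ (resp. $\mathcal B$) is the set of these vectors. $\mathcal U':=\mathcal B'\cap\mathcal D^\flat$, $\mathcal U'':=\mathcal B\cap\mathcal D^\sharp$. Cones: $\mathcal P^\flat:=\{g\ast g^\flat:g\in\mathcal U'\}^-$, $\mathcal P^\sharp:=\{g\ast g^\sharp:g\in\mathcal U''\}^-$, and $\mathfrak P:=(\Delta^{-1/4}\mathcal P^\flat)^-=(\Delta^{1/4}\mathcal P^\sharp)^-$ (bars: closure in $L^2(G)$), a self-dual closed convex cone of $L^2(G)$. *)

theory Defs
  imports "HOL-Analysis.Analysis"
begin

section \<open>Locally compact groups and Haar measure\<close>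

text \<open>
  Groups are written additively, as in the library class \<open>topological_group_add\<close>, which does
  not assume commutativity: \<open>s + t\<close> is the product st, \<open>- s\<close> is the inverse of s, and
  \<open>- s + t\<close> is the product of the inverse of s with t. The order of the summands matters.

  The class axiom says that the Hausdorff space is a \<open>locally_compact_space\<close>; it is unfolded here because
  \<open>euclidean\<close> is not available inside a class specification.
\<close>

class locally_compact_group = topological_group_add + t2_space +
  assumes locally_compact: "\<exists>U K. open U \<and> compact K \<and> x \<in> U \<and> U \<subseteq> K"

text \<open>No countability is assumed of the group, so regularity is part of the definition.\<close>

definition left_haar_measure :: "'a::locally_compact_group measure \<Rightarrow> bool" where
  "left_haar_measure M \<longleftrightarrow>
     sets M = sets borel \<and>
     emeasure M UNIV \<noteq> 0 \<and>
     (\<forall>K. compact K \<longrightarrow> emeasure M K < \<infinity>) \<and>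
     (\<forall>A\<in>sets borel. emeasure M A = (INF U\<in>{U. open U \<and> A \<subseteq> U}. emeasure M U)) \<and>
     (\<forall>U. open U \<longrightarrow> emeasure M U = (SUP K\<in>{K. compact K \<and> K \<subseteq> U}. emeasure M K)) \<and>
     (\<forall>s. \<forall>A\<in>sets borel. emeasure M ((\<lambda>t. s + t) ` A) = emeasure M A)"

text \<open>
  The convention is \<open>d(st) = \<delta>(t) ds\<close>. For a left Haar measure there is exactly one such
  \<open>\<delta>\<close>; it is a continuous homomorphism into the positive reals.
\<close>

definition modular_function :: "'a::locally_compact_group measure \<Rightarrow> ('a \<Rightarrow> real) \<Rightarrow> bool" where
  "modular_function M \<delta> \<longleftrightarrow>
     (\<forall>t. 0 < \<delta> t \<and>
        (\<forall>A\<in>sets borel. emeasure M ((\<lambda>s. s + t) ` A) = ennreal (\<delta> t) * emeasure M A))"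

definition compactly_supported :: "('a::topological_space \<Rightarrow> complex) set" where
  "compactly_supported = {f. continuous_on UNIV f \<and> compact (closure {s. f s \<noteq> 0})}"


section \<open>The space of square integrable functions\<close>

text \<open>
  Elements are represented by measurable functions rather than by classes modulo equality almost
  everywhere. Closures are saturated under equality almost everywhere, and equations between
  elements are stated with \<open>AE\<close>.
\<close>

definition L2 :: "'a measure \<Rightarrow> ('a \<Rightarrow> complex) set" where
  "L2 M = {f \<in> borel_measurable M. integrable M (\<lambda>x. (cmod (f x))\<^sup>2)}"

definition L2_inner :: "'a measure \<Rightarrow> ('a \<Rightarrow> complex) \<Rightarrow> ('a \<Rightarrow> complex) \<Rightarrow> complex" where
  "L2_inner M f g = (\<integral>x. f x * cnj (g x) \<partial>M)"

definition L2_norm :: "'a measure \<Rightarrow> ('a \<Rightarrow> complex) \<Rightarrow> real" where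
  "L2_norm M f = sqrt (\<integral>x. (cmod (f x))\<^sup>2 \<partial>M)"

definition L2_orthogonal :: "'a measure \<Rightarrow> ('a \<Rightarrow> complex) set \<Rightarrow> ('a \<Rightarrow> complex) set \<Rightarrow> bool" where
  "L2_orthogonal M A B \<longleftrightarrow> (\<forall>f\<in>A. \<forall>g\<in>B. L2_inner M f g = 0)"

text \<open>
  The intersection with \<open>L2 M\<close> matters: a function that is not square integrable has
  \<open>L2_norm\<close> zero, by the convention for non-integrable functions.
\<close>

definition L2_closure :: "'a measure \<Rightarrow> ('a \<Rightarrow> complex) set \<Rightarrow> ('a \<Rightarrow> complex) set" where
  "L2_closure M S =
     {f \<in> L2 M. \<forall>\<epsilon>>0. \<exists>h\<in>S \<inter> L2 M. L2_norm M (\<lambda>x. f x - h x) < \<epsilon>}"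

definition L2_closed_span :: "'a measure \<Rightarrow> ('a \<Rightarrow> complex) set \<Rightarrow> ('a \<Rightarrow> complex) set" where
  "L2_closed_span M S =
     L2_closure M {(\<lambda>x. \<Sum>f\<in>F. c f * f x) | F c. finite F \<and> F \<subseteq> S}"

text \<open>
  The last clause, applied to differences, makes \<open>T\<close> compatible with equality almost
  everywhere. Values of \<open>T\<close> outside \<open>L2 M\<close> are irrelevant.
\<close>

definition L2_bounded_operator ::
    "'a measure \<Rightarrow> (('a \<Rightarrow> complex) \<Rightarrow> ('a \<Rightarrow> complex)) \<Rightarrow> bool" where
  "L2_bounded_operator M T \<longleftrightarrow>
     (\<forall>f\<in>L2 M. T f \<in> L2 M) \<and>
     (\<forall>f\<in>L2 M. \<forall>g\<in>L2 M. AE x in M. T (\<lambda>y. f y + g y) x = T f x + T g x) \<and>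
     (\<forall>c. \<forall>f\<in>L2 M. AE x in M. T (\<lambda>y. c * f y) x = c * T f x) \<and>
     (\<exists>C. \<forall>f\<in>L2 M. L2_norm M (T f) \<le> C * L2_norm M f)"

definition L2_commutant ::
    "'a measure \<Rightarrow> (('a \<Rightarrow> complex) \<Rightarrow> ('a \<Rightarrow> complex)) set
       \<Rightarrow> (('a \<Rightarrow> complex) \<Rightarrow> ('a \<Rightarrow> complex)) set" where
  "L2_commutant M X =
     {T. L2_bounded_operator M T \<and>
         (\<forall>S\<in>X. \<forall>f\<in>L2 M. AE x in M. T (S f) x = S (T f) x)}"


section \<open>The left von Neumann algebra and the self-dual cone\<close>

definition left_regular :: "'a::group_add \<Rightarrow> ('a \<Rightarrow> complex) \<Rightarrow> ('a \<Rightarrow> complex)" where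
  "left_regular s f = (\<lambda>t. f (- s + t))"

definition left_group_algebra ::
    "'a::locally_compact_group measure \<Rightarrow> (('a \<Rightarrow> complex) \<Rightarrow> ('a \<Rightarrow> complex)) set" where
  "left_group_algebra M = L2_commutant M (L2_commutant M (range left_regular))"

definition modular_power :: "('a \<Rightarrow> real) \<Rightarrow> real \<Rightarrow> ('a \<Rightarrow> complex) \<Rightarrow> ('a \<Rightarrow> complex)" where
  "modular_power \<delta> \<alpha> f = (\<lambda>s. complex_of_real (\<delta> s powr \<alpha>) * f s)"

definition modular_power_domain ::
    "'a measure \<Rightarrow> ('a \<Rightarrow> real) \<Rightarrow> real \<Rightarrow> ('a \<Rightarrow> complex) set" where
  "modular_power_domain M \<delta> \<alpha> = {f \<in> L2 M. modular_power \<delta> \<alpha> f \<in> L2 M}"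

definition convolution ::
    "'a::group_add measure \<Rightarrow> ('a \<Rightarrow> complex) \<Rightarrow> ('a \<Rightarrow> complex) \<Rightarrow> ('a \<Rightarrow> complex)" where
  "convolution M f g = (\<lambda>s. \<integral>t. f t * g (- t + s) \<partial>M)"

definition flat :: "('a::group_add \<Rightarrow> complex) \<Rightarrow> ('a \<Rightarrow> complex)" where
  "flat f = (\<lambda>s. cnj (f (- s)))"

definition flat_domain :: "'a measure \<Rightarrow> ('a \<Rightarrow> real) \<Rightarrow> ('a \<Rightarrow> complex) set" where
  "flat_domain M \<delta> = {f \<in> L2 M. integrable M (\<lambda>s. inverse (\<delta> s) * (cmod (f s))\<^sup>2)}"

definition right_bounded :: "'a::locally_compact_group measure \<Rightarrow> ('a \<Rightarrow> complex) set" where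
  "right_bounded M =
     {g \<in> L2 M. (\<forall>f\<in>compactly_supported. convolution M f g \<in> L2 M) \<and>
        (\<exists>C. \<forall>f\<in>compactly_supported. L2_norm M (convolution M f g) \<le> C * L2_norm M f)}"

definition right_hilbert_algebra ::
    "'a::locally_compact_group measure \<Rightarrow> ('a \<Rightarrow> real) \<Rightarrow> ('a \<Rightarrow> complex) set" where
  "right_hilbert_algebra M \<delta> = right_bounded M \<inter> flat_domain M \<delta>"

definition flat_cone ::
    "'a::locally_compact_group measure \<Rightarrow> ('a \<Rightarrow> real) \<Rightarrow> ('a \<Rightarrow> complex) set" where
  "flat_cone M \<delta> = L2_closure M ((\<lambda>g. convolution M g (flat g)) ` right_hilbert_algebra M \<delta>)"

definition self_dual_cone ::
    "'a::locally_compact_group measure \<Rightarrow> ('a \<Rightarrow> real) \<Rightarrow> ('a \<Rightarrow> complex) set" where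
  "self_dual_cone M \<delta> =
     L2_closure M
       (modular_power \<delta> (-1/4) ` (flat_cone M \<delta> \<inter> modular_power_domain M \<delta> (-1/4)))"


section \<open>Unitary representations and admissible vectors\<close>

text \<open>
  Complex Hilbert spaces; the inner product is linear in the first variable. Positive definiteness
  is contained in \<open>cinner_self\<close>. The zero space is not excluded here.
\<close>

class complex_hilbert_space = banach +
  fixes scaleC :: "complex \<Rightarrow> 'a \<Rightarrow> 'a"  (infixr \<open>*\<^sub>C\<close> 75)
    and cinner :: "'a \<Rightarrow> 'a \<Rightarrow> complex"
  assumes scaleC_add_right: "a *\<^sub>C (x + y) = a *\<^sub>C x + a *\<^sub>C y"
    and scaleC_add_left: "(a + b) *\<^sub>C x = a *\<^sub>C x + b *\<^sub>C x"
    and scaleC_scaleC: "a *\<^sub>C (b *\<^sub>C x) = (a * b) *\<^sub>C x"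
    and scaleC_of_real: "complex_of_real r *\<^sub>C x = r *\<^sub>R x"
    and cinner_commute: "cinner x y = cnj (cinner y x)"
    and cinner_add_left: "cinner (x + y) z = cinner x z + cinner y z"
    and cinner_scaleC_left: "cinner (a *\<^sub>C x) y = a * cinner x y"
    and cinner_self: "cinner x x = complex_of_real ((norm x)\<^sup>2)"

definition unitary_operator :: "('h::complex_hilbert_space \<Rightarrow> 'h) \<Rightarrow> bool" where
  "unitary_operator U \<longleftrightarrow>
     (\<forall>x y. U (x + y) = U x + U y) \<and> (\<forall>a x. U (a *\<^sub>C x) = a *\<^sub>C U x) \<and>
     (\<forall>x y. cinner (U x) (U y) = cinner x y) \<and> surj U"

definition unitary_representation ::
    "('a::locally_compact_group \<Rightarrow> 'h::complex_hilbert_space \<Rightarrow> 'h) \<Rightarrow> bool" where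
  "unitary_representation \<pi> \<longleftrightarrow>
     (\<exists>x::'h. x \<noteq> 0) \<and>
     (\<forall>s. unitary_operator (\<pi> s)) \<and>
     (\<forall>s t. \<pi> (s + t) = \<pi> s \<circ> \<pi> t) \<and>
     (\<forall>x. continuous_on UNIV (\<lambda>s. \<pi> s x))"

definition wavelet_transform ::
    "('a \<Rightarrow> 'h::complex_hilbert_space \<Rightarrow> 'h) \<Rightarrow> 'h \<Rightarrow> 'h \<Rightarrow> 'a \<Rightarrow> complex" where
  "wavelet_transform \<pi> \<eta> \<psi> = (\<lambda>s. cinner \<psi> (\<pi> s \<eta>))"

definition is_adjoint ::
    "'a measure \<Rightarrow> ('h::complex_hilbert_space \<Rightarrow> 'a \<Rightarrow> complex) \<Rightarrow> (('a \<Rightarrow> complex) \<Rightarrow> 'h) \<Rightarrow> bool"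
  where
  "is_adjoint M L A \<longleftrightarrow> (\<forall>\<psi>. \<forall>f\<in>L2 M. L2_inner M (L \<psi>) f = cinner \<psi> (A f))"

text \<open>
  The adjoint is determined on \<open>L2 M\<close>, so the existential quantifier below expresses that
  the adjoint of the transform is a left inverse of it.
\<close>

definition admissible ::
    "'a::locally_compact_group measure \<Rightarrow> ('a \<Rightarrow> 'h::complex_hilbert_space \<Rightarrow> 'h) \<Rightarrow> 'h \<Rightarrow> bool"
  where
  "admissible M \<pi> \<eta> \<longleftrightarrow>
     (\<forall>\<psi>. wavelet_transform \<pi> \<eta> \<psi> \<in> L2 M) \<and>
     (\<exists>C. \<forall>\<psi>. L2_norm M (wavelet_transform \<pi> \<eta> \<psi>) \<le> C * norm \<psi>) \<and>
     (\<exists>A. is_adjoint M (wavelet_transform \<pi> \<eta>) A \<and>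
          (\<forall>\<psi>. A (wavelet_transform \<pi> \<eta> \<psi>) = \<psi>))"

definition g_fun :: "('a \<Rightarrow> 'h::complex_hilbert_space \<Rightarrow> 'h) \<Rightarrow> 'h \<Rightarrow> 'a \<Rightarrow> complex" where
  "g_fun \<pi> \<eta> = (\<lambda>s. cinner \<eta> (\<pi> s \<eta>))"

definition H_hat ::
    "'a::locally_compact_group measure \<Rightarrow> ('a \<Rightarrow> real)
       \<Rightarrow> ('a \<Rightarrow> 'h::complex_hilbert_space \<Rightarrow> 'h) \<Rightarrow> 'h \<Rightarrow> ('a \<Rightarrow> complex) set" where
  "H_hat M \<delta> \<pi> \<eta> =
     L2_closed_span M {T (modular_power \<delta> (-1/4) (g_fun \<pi> \<eta>)) | T. T \<in> left_group_algebra M}"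

definition P_hat ::
    "'a::locally_compact_group measure \<Rightarrow> ('a \<Rightarrow> real)
       \<Rightarrow> ('a \<Rightarrow> 'h::complex_hilbert_space \<Rightarrow> 'h) \<Rightarrow> 'h \<Rightarrow> ('a \<Rightarrow> complex) set" where
  "P_hat M \<delta> \<pi> \<eta> = self_dual_cone M \<delta> \<inter> H_hat M \<delta> \<pi> \<eta>"

end

(* Write J f = \<delta> powr (-1/2) * flat f. Right convolution by g_i is the projection R_i onto the range
   of the transform of \<eta>_i, and J (R_2 (J g_1)) = R_1 (J g_2). Since J is antiunitary, the inner product
   in (i) is <g_1, J g_2> = <R_1 g_1, J g_2> = <g_1, J (R_2 (J g_1))> = |R_2 (J g_1)|^2. If it vanishes,
   so does the continuous function R_2 (J g_1), whose values are, up to positive factors, the inner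
   products of the first vector with the translates of the second; the projection onto the
   complement of the orbit then lies in the commutant and gives (iii). Conversely g_i = g_i * flat g_i
   puts the vectors of (i) into the cones. That J is antiunitary is the inversion formula for Haar
   measure, proved here for continuous integrands only. *)

theory Submission
  imports Defs
begin

section \<open>Haar measure and the modular function\<close>

text \<open>The group need be neither second countable nor sigma-compact, so Haar measure may fail
  to be sigma-finite; this shapes the section on inversion. Regularity and continuity replace
  countability: the integral of a nonnegative continuous function is controlled by its compactly
  supported continuous minorants, and the functions that inversion is applied to are built from
  matrix coefficients and powers of \<open>\<delta>\<close>. Convolution by \<open>g\<close> is a
  projection because \<open>g (- t + s)\<close> is the inner product of
  \<open>\<pi> t \<eta>\<close> and \<open>\<pi> s \<eta>\<close>; it therefore equals the isometry
  \<open>W\<close> after its adjoint \<open>A\<close>. The two weights \<open>-1/4\<close> in (i)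
  add up to the \<open>-1/2\<close> of J, and J g is \<open>g\<close> with that weight since
  \<open>flat g = g\<close>. Elements of \<open>L2 M\<close> are functions, so most identities hold
  only almost everywhere, while the orbit argument needs a value for each single translate. It gets
  one because the quantity that vanishes is the norm of a vector of the representation space, and a
  zero vector has all its coefficients zero.\<close>

lemma vimage_add_left: "(\<lambda>t. s + t) -` A = (\<lambda>t. - s + t) ` A" for s :: "'a::group_add"
proof (rule set_eqI, rule iffI)
  fix x assume "x \<in> (\<lambda>t. s + t) -` A"
  then have "s + x \<in> A" by simp
  then show "x \<in> (\<lambda>t. - s + t) ` A"
    by (rule rev_image_eqI) simp
next
  fix x assume "x \<in> (\<lambda>t. - s + t) ` A"
  then obtain a where "a \<in> A" "x = - s + a" by blast
  then show "x \<in> (\<lambda>t. s + t) -` A" by simp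
qed

lemma vimage_add_right: "(\<lambda>t. t + s) -` A = (\<lambda>t. t + - s) ` A" for s :: "'a::group_add"
proof (rule set_eqI, rule iffI)
  fix x assume "x \<in> (\<lambda>t. t + s) -` A"
  then have "x + s \<in> A" by simp
  then show "x \<in> (\<lambda>t. t + - s) ` A"
    by (rule rev_image_eqI) simp
next
  fix x assume "x \<in> (\<lambda>t. t + - s) ` A"
  then obtain a where "a \<in> A" "x = a + - s" by blast
  then show "x \<in> (\<lambda>t. t + s) -` A" by simp
qed

section \<open>Urysohn functions of compact support\<close>

lemma compact_in_open_in_compact:
  fixes K :: "'a::locally_compact_group set"
  assumes "compact K"
  obtains V L where "open V" "compact L" "K \<subseteq> V" "V \<subseteq> L"
proof -
  have "\<forall>x::'a. \<exists>U L. open U \<and> compact L \<and> x \<in> U \<and> U \<subseteq> L"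
    by (rule allI, rule locally_compact)
  from choice[OF this] obtain U
    where "\<forall>x::'a. \<exists>L. open (U x) \<and> compact L \<and> x \<in> U x \<and> U x \<subseteq> L" ..
  from choice[OF this] obtain L
    where "\<forall>x::'a. open (U x) \<and> compact (L x) \<and> x \<in> U x \<and> U x \<subseteq> L x" ..
  then have UL: "\<And>x. open (U x)" "\<And>x. compact (L x)" "\<And>x. x \<in> U x" "\<And>x. U x \<subseteq> L x"
    by simp_all
  have "K \<subseteq> (\<Union>x\<in>K. U x)" using UL(3) by blast
  then obtain T where T: "T \<subseteq> K" "finite T" "K \<subseteq> (\<Union>x\<in>T. U x)"
    by (rule compactE_image[OF assms UL(1)])
  show thesis
  proof (rule that)
    show "open (\<Union>x\<in>T. U x)" using UL(1) by (intro open_UN) simp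
    show "compact (\<Union>x\<in>T. L x)" using T(2) UL(2) by (intro compact_UN) simp_all
    show "(\<Union>x\<in>T. U x) \<subseteq> (\<Union>x\<in>T. L x)" using UL(4) by (intro UN_mono subset_refl)
  qed fact
qed

text \<open>Locally compact Hausdorff spaces are completely regular, so \<open>K\<close> can be
  separated from the closed complement of a neighbourhood \<open>V\<close>. Taking \<open>V\<close>
  inside a compact \<open>L\<close> makes the separating function vanish off
  \<open>L\<close>.\<close>

lemma Urysohn_compact:
  fixes K :: "'a::locally_compact_group set"
  assumes K: "compact K"
  obtains u :: "'a \<Rightarrow> real" and L where "continuous_on UNIV u" "\<And>x. 0 \<le> u x" "\<And>x. u x \<le> 1"
    "\<And>x. x \<in> K \<Longrightarrow> u x = 1" "compact L" "\<And>x. x \<notin> L \<Longrightarrow> u x = 0"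
proof -
  obtain V L where V: "open V" "compact L" "K \<subseteq> V" "V \<subseteq> L"
    using compact_in_open_in_compact[OF K] .
  have "locally_compact_space (euclidean::'a topology)"
    using locally_compact
    unfolding locally_compact_space_def open_openin[symmetric] compactin_euclidean_iff by blast
  moreover have "Hausdorff_space (euclidean::'a topology)"
    unfolding Hausdorff_space_def using hausdorff[where 'a='a] by (auto simp: disjnt_def)
  ultimately have "completely_regular_space (euclidean::'a topology)"
    by (intro locally_compact_regular_imp_completely_regular_space
          locally_compact_Hausdorff_imp_regular_space) auto
  then obtain u where u: "continuous_map euclidean (top_of_set {0..1::real}) u"
      "u ` (- V) \<subseteq> {0}" "u ` K \<subseteq> {1}"
    using Urysohn_completely_regular_compact_closed[of 0 1 euclidean K "- V"] K V
    by (auto simp: disjnt_def compactin_euclidean_iff)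
  show thesis
  proof (rule that[of u L])
    show "continuous_on UNIV u"
      using u(1) by (simp add: continuous_map_in_subtopology)
    show "0 \<le> u x" "u x \<le> 1" for x
      using u(1) by (auto simp: continuous_map_in_subtopology)
    show "u x = 1" if "x \<in> K" for x using u(3) that by blast
    show "u x = 0" if "x \<notin> L" for x using u(2) V(4) that by blast
  qed fact
qed

locale haar_group =
  fixes M :: "'a::locally_compact_group measure" and \<delta> :: "'a \<Rightarrow> real"
  assumes haar: "left_haar_measure M" and modular: "modular_function M \<delta>"
begin

lemma sets_M [measurable_cong]: "sets M = sets borel"
  using haar by (simp add: left_haar_measure_def)

lemma space_M [simp]: "space M = UNIV"
  using sets_eq_imp_space_eq[OF sets_M] by simp

lemma emeasure_compact: "compact K \<Longrightarrow> emeasure M K < \<infinity>"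
  using haar by (simp add: left_haar_measure_def)

lemma borel_set: "open U \<Longrightarrow> U \<in> sets M" "closed U \<Longrightarrow> U \<in> sets M" "compact U \<Longrightarrow> U \<in> sets M"
  by (auto simp: sets_M borel_compact)

lemma outer_regular: "A \<in> sets M \<Longrightarrow> emeasure M A = (INF U\<in>{U. open U \<and> A \<subseteq> U}. emeasure M U)"
  using haar by (auto simp: left_haar_measure_def)

lemma inner_regular: "open U \<Longrightarrow> emeasure M U = (SUP K\<in>{K. compact K \<and> K \<subseteq> U}. emeasure M K)"
  using haar by (auto simp: left_haar_measure_def)

lemma emeasure_left: "A \<in> sets M \<Longrightarrow> emeasure M ((\<lambda>t. s + t) ` A) = emeasure M A"
  using haar by (auto simp: left_haar_measure_def sets_M)

lemma emeasure_right: "A \<in> sets M \<Longrightarrow> emeasure M ((\<lambda>s. s + t) ` A) = ennreal (\<delta> t) * emeasure M A"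
  using modular by (auto simp: modular_function_def sets_M)

lemma delta_pos [simp]: "0 < \<delta> t"
  using modular by (auto simp: modular_function_def)

lemma delta_nonneg [simp]: "0 \<le> \<delta> t" "\<delta> t \<noteq> 0"
  using less_imp_le[OF delta_pos[of t]] less_imp_neq[OF delta_pos[of t], symmetric] by blast+

lemma continuous_measurable:
  fixes f :: "'a \<Rightarrow> 'b::topological_space"
  shows "continuous_on UNIV f \<Longrightarrow> f \<in> borel_measurable M"
  using borel_measurable_continuous_onI measurable_cong_sets[OF sets_M refl] by blast

lemma measurable_translation:
  "(\<lambda>t. s + t) \<in> measurable M M" "(\<lambda>t. t + s) \<in> measurable M M" "uminus \<in> measurable M M"
proof -
  have "continuous_on UNIV (\<lambda>t. s + t)" "continuous_on UNIV (\<lambda>t. t + s)" "continuous_on UNIV (uminus::'a\<Rightarrow>'a)"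
    by (intro continuous_intros)+
  then show "(\<lambda>t. s + t) \<in> measurable M M" "(\<lambda>t. t + s) \<in> measurable M M" "uminus \<in> measurable M M"
    using continuous_measurable measurable_cong_sets[OF refl sets_M] by blast+
qed

text \<open>Invariance is stated for images, while \<open>distr\<close> measures preimages;
  \<open>vimage_add_left\<close> turns a preimage under translation by \<open>s\<close> into an
  image under translation by \<open>- s\<close>.\<close>

lemma distr_left: "distr M M (\<lambda>t. s + t) = M"
proof (rule measure_eqI)
  fix A assume "A \<in> sets (distr M M (\<lambda>t. s + t))"
  then have A: "A \<in> sets M" by simp
  show "emeasure (distr M M (\<lambda>t. s + t)) A = emeasure M A"
    using A by (simp add: emeasure_distr measurable_translation vimage_add_left emeasure_left)
qed simp

text \<open>The sign arises because the preimage of a set under right translation by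
  \<open>t\<close> is its right translate by \<open>- t\<close>.\<close>

lemma distr_right: "distr M M (\<lambda>s. s + t) = scale_measure (ennreal (\<delta> (- t))) M"
proof (rule measure_eqI)
  fix A assume "A \<in> sets (distr M M (\<lambda>s. s + t))"
  then have A: "A \<in> sets M" by simp
  show "emeasure (distr M M (\<lambda>s. s + t)) A = emeasure (scale_measure (ennreal (\<delta> (- t))) M) A"
    unfolding emeasure_scale_measure emeasure_right[OF A, symmetric]
    using A by (simp only: emeasure_distr measurable_translation vimage_add_right space_M Int_UNIV_right)
qed simp

lemma integral_left:
  fixes f :: "'a \<Rightarrow> 'b::{banach, second_countable_topology}"
  assumes "f \<in> borel_measurable M"
  shows "(\<integral>t. f (s + t) \<partial>M) = (\<integral>t. f t \<partial>M)"
  using integral_distr[OF measurable_translation(1) assms, of s] by (simp add: distr_left)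

lemma integrable_left:
  fixes f :: "'a \<Rightarrow> 'b::{banach, second_countable_topology}"
  assumes "integrable M f"
  shows "integrable M (\<lambda>t. f (s + t))"
  using integrable_distr[OF measurable_translation(1), of s f] assms by (simp add: distr_left)

lemma nn_integral_right:
  assumes "f \<in> borel_measurable M"
  shows "(\<integral>\<^sup>+s. f (s + t) \<partial>M) = ennreal (\<delta> (- t)) * (\<integral>\<^sup>+s. f s \<partial>M)"
  using nn_integral_distr[OF measurable_translation(2), of f t] assms
  by (simp add: distr_right nn_integral_scale_measure)

lemma integral_right:
  fixes f :: "'a \<Rightarrow> real"
  assumes "f \<in> borel_measurable M" "\<And>x. 0 \<le> f x"
  shows "(\<integral>s. f (s + t) \<partial>M) = \<delta> (- t) * (\<integral>s. f s \<partial>M)"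
proof -
  have "(\<lambda>s. f (s + t)) \<in> borel_measurable M"
    using assms(1) measurable_translation(2)[of t] by measurable
  then show ?thesis
    using nn_integral_right[of "\<lambda>s. ennreal (f s)" t] assms
    by (simp add: integral_eq_nn_integral enn2real_mult)
qed

text \<open>The translates of a null open set are null, and finitely many of them cover any compact
  set; inner regularity of the whole group would then make \<open>M\<close> zero.\<close>

lemma open_positive:
  assumes U: "open U" "U \<noteq> {}"
  shows "0 < emeasure M U"
proof (rule ccontr)
  assume "\<not> 0 < emeasure M U"
  then have U0: "emeasure M U = 0" by simp
  obtain u where u: "u \<in> U" using U by blast
  have "emeasure M K = 0" if K: "compact K" for K
  proof -
    have op: "open ((\<lambda>t. s + t) ` U)" for s
    proof -
      have "continuous_on UNIV (\<lambda>t. - s + t)" by (intro continuous_intros)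
      then show ?thesis
        using vimage_add_left[of "- s" U] open_vimage[OF U(1), of "\<lambda>t. - s + t"] by simp
    qed
    \<comment> \<open>Translation by \<open>k + - u\<close> carries \<open>u\<close> to
      \<open>k\<close>, so a single point of \<open>U\<close> yields a cover by translates.\<close>
    have "k \<in> (\<lambda>t. (k + - u) + t) ` U" for k
      using u by (intro image_eqI[of _ _ u]) auto
    then have "K \<subseteq> (\<Union>k\<in>K. (\<lambda>t. (k + - u) + t) ` U)" by blast
    then obtain T where T: "T \<subseteq> K" "finite T" "K \<subseteq> (\<Union>k\<in>T. (\<lambda>t. (k + - u) + t) ` U)"
      by (rule compactE_image[OF K op])
    have "emeasure M K \<le> emeasure M (\<Union>k\<in>T. (\<lambda>t. (k + - u) + t) ` U)"
      using T(2,3) op by (intro emeasure_mono) (auto intro: borel_set(1))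
    also have "\<dots> \<le> (\<Sum>k\<in>T. emeasure M ((\<lambda>t. (k + - u) + t) ` U))"
      using T(2,3) op by (intro emeasure_subadditive_finite) (auto intro: borel_set(1))
    also have "\<dots> = 0"
      using U U0 by (simp add: emeasure_left borel_set)
    finally show ?thesis by simp
  qed
  then have "emeasure M UNIV = 0"
    using inner_regular[of UNIV] by (simp add: SUP_eq_const[of "{K. compact K}" _ 0] exI[of _ "{}"])
  then show False
    using haar by (simp add: left_haar_measure_def)
qed

section \<open>The modular function as a continuous homomorphism\<close>

lemma compact_positive:
  obtains K where "compact K" "0 < measure M K" "emeasure M K = ennreal (measure M K)"
proof -
  obtain U K where U: "open U" "compact K" "(0::'a) \<in> U" "U \<subseteq> K"
    using locally_compact by blast
  have "0 < emeasure M U" using open_positive U by blast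
  also have "\<dots> \<le> emeasure M K" using U by (intro emeasure_mono) (auto simp: borel_set)
  finally have "0 < emeasure M K" .
  moreover have "emeasure M K = ennreal (measure M K)"
    using emeasure_compact[OF U(2)] by (intro emeasure_eq_ennreal_measure) auto
  ultimately show thesis
    using U(2) by (intro that[of K]) auto
qed

text \<open>Right translation by \<open>s + t\<close> is right translation by \<open>s\<close>
  followed by that by \<open>t\<close>. On a compact set of positive finite measure the measure can
  be cancelled.\<close>

lemma delta_add: "\<delta> (s + t) = \<delta> s * \<delta> t"
proof -
  obtain K where K: "compact K" "0 < measure M K" "emeasure M K = ennreal (measure M K)"
    using compact_positive .
  have m: "(\<lambda>x. x + s) ` K \<in> sets M"
    using K by (intro borel_set compact_continuous_image) (auto intro!: continuous_intros)
  have "emeasure M ((\<lambda>x. x + (s + t)) ` K) = emeasure M ((\<lambda>x. x + t) ` ((\<lambda>x. x + s) ` K))"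
    by (simp add: image_image add.assoc)
  then have "ennreal (\<delta> (s + t) * measure M K) = ennreal (\<delta> t * (\<delta> s * measure M K))"
    using emeasure_right[OF m] emeasure_right[of K] K by (simp add: borel_set ennreal_mult)
  then show ?thesis using K(2) by (simp add: ennreal_inj)
qed

lemma delta_0 [simp]: "\<delta> 0 = 1"
  using delta_add[of 0 0] by simp

lemma delta_minus: "\<delta> (- s) = inverse (\<delta> s)"
  using delta_add[of s "- s"] by (simp add: field_simps)

lemma delta_powr_add: "\<delta> (s + t) powr a = \<delta> s powr a * \<delta> t powr a"
  by (simp add: delta_add powr_mult)

lemma delta_powr_minus: "\<delta> (- s) powr a = \<delta> s powr (- a)"
  by (simp add: delta_minus powr_minus inverse_powr)

text \<open>Outer regularity of a compact set of positive measure gives upper semicontinuity at the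
  unit, and \<open>\<delta> (- s) = inverse (\<delta> s)\<close> turns this into continuity.\<close>

lemma delta_continuous: "continuous_on A \<delta>"
proof -
  obtain K where K: "compact K" "0 < measure M K" "emeasure M K = ennreal (measure M K)"
    using compact_positive .
  have up: "\<exists>V. open V \<and> 0 \<in> V \<and> (\<forall>t\<in>V. \<delta> t < 1 + e)" if e: "e > 0" for e
  proof -
    \<comment> \<open>Some open \<open>U\<close> around \<open>K\<close> has measure below
      \<open>1 + e\<close> times that of \<open>K\<close>. By the tube lemma all right translates of
      \<open>K\<close> by elements near the unit stay inside \<open>U\<close>, which bounds
      \<open>\<delta>\<close> from above there.\<close>
    have "(INF U\<in>{U. open U \<and> K \<subseteq> U}. emeasure M U) < ennreal ((1 + e) * measure M K)"
      unfolding outer_regular[OF borel_set(3)[OF K(1)], symmetric] K(3)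
      using K(2) e by (simp add: ennreal_less_iff)
    then obtain U where U: "open U" "K \<subseteq> U" "emeasure M U < ennreal ((1 + e) * measure M K)"
      unfolding INF_less_iff by blast
    have "open ((\<lambda>(t::'a, k). k + t) -` U)"
      using U(1) by (intro open_vimage) (auto simp: case_prod_unfold intro!: continuous_intros)
    obtain V where V: "0 \<in> V" "open V" "V \<times> K \<subseteq> (\<lambda>(t, k). k + t) -` U"
    proof -
      have "{0} \<times> K \<subseteq> (\<lambda>(t, k). k + t) -` U" using U(2) by auto
      from Elementary_Topology.tube_lemma[OF K(1) \<open>open ((\<lambda>(t::'a, k). k + t) -` U)\<close> this]
      show thesis using that by blast
    qed
    have "\<delta> t < 1 + e" if "t \<in> V" for t
    proof -
      have "ennreal (\<delta> t * measure M K) = emeasure M ((\<lambda>x. x + t) ` K)"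
        using emeasure_right[of K t] K by (simp add: borel_set ennreal_mult)
      also have "\<dots> \<le> emeasure M U"
        using V that U(1) by (intro emeasure_mono) (auto intro!: borel_set)
      also have "\<dots> < ennreal ((1 + e) * measure M K)" by fact
      finally show ?thesis using K(2) e by (simp add: ennreal_less_iff)
    qed
    with V show ?thesis by blast
  qed
  have at0: "\<exists>V. open V \<and> 0 \<in> V \<and> (\<forall>t\<in>V. \<bar>\<delta> t - 1\<bar> < e)" if e: "e > 0" for e
  proof -
    obtain V where V: "open V" "0 \<in> V" "\<forall>t\<in>V. \<delta> t < 1 + e" using up[OF e] by blast
    have "\<bar>\<delta> t - 1\<bar> < e" if "t \<in> V" "- t \<in> V" for t
    proof -
      have "inverse (\<delta> t) < 1 + e" "\<delta> t < 1 + e" using V that delta_minus[of t] by auto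
      moreover have "\<delta> t * inverse (\<delta> t) = 1" by simp
      moreover have "1 - e < \<delta> t"
      proof (cases "e < 1")
        case True
        \<comment> \<open>The upper bound at \<open>- t\<close> says that \<open>\<delta> t\<close>
          exceeds \<open>1 / (1 + e)\<close>, which in turn exceeds \<open>1 - e\<close>.\<close>
        have "(1 - e) * (1 + e) < 1" using e by (simp add: algebra_simps)
        also have "1 < \<delta> t * (1 + e)"
          using \<open>inverse (\<delta> t) < 1 + e\<close> by (simp add: field_simps)
        finally show ?thesis using e by (simp add: mult_less_cancel_right)
      next
        case False
        then show ?thesis using delta_pos[of t] by linarith
      qed
      ultimately show ?thesis by linarith
    qed
    moreover have "open (V \<inter> uminus -` V)"
      using V(1) by (intro open_Int open_vimage) (auto intro!: continuous_intros)
    ultimately show ?thesis using V by (intro exI[of _ "V \<inter> uminus -` V"]) auto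
  qed
  have "isCont \<delta> x" for x
    unfolding isCont_def
  proof (rule tendstoI)
    fix e :: real assume "e > 0"
    \<comment> \<open>The tolerance is divided by \<open>\<delta> x\<close> because
      \<open>\<delta> y - \<delta> x\<close> is \<open>\<delta> x\<close> times
      \<open>\<delta> (- x + y) - 1\<close>.\<close>
    then obtain V where V: "open V" "0 \<in> V" "\<forall>t\<in>V. \<bar>\<delta> t - 1\<bar> < e / \<delta> x"
      using at0[of "e / \<delta> x"] by auto
    have "open ((\<lambda>y. - x + y) -` V)"
      using V by (intro open_vimage) (auto intro!: continuous_intros)
    moreover have "dist (\<delta> y) (\<delta> x) < e" if "- x + y \<in> V" for y
    proof -
      have "\<delta> y = \<delta> x * \<delta> (- x + y)"
        unfolding delta_add[symmetric] by simp
      then have "dist (\<delta> y) (\<delta> x) = \<delta> x * \<bar>\<delta> (- x + y) - 1\<bar>"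
        using abs_mult[of "\<delta> x" "\<delta> (- x + y) - 1"] by (simp add: dist_real_def right_diff_distrib)
      also have "\<dots> < \<delta> x * (e / \<delta> x)"
        using V that by (intro mult_strict_left_mono) auto
      finally show ?thesis by simp
    qed
    ultimately show "\<forall>\<^sub>F y in at x. dist (\<delta> y) (\<delta> x) < e"
      unfolding eventually_at_topological using V
      by (intro exI[of _ "(\<lambda>y. - x + y) -` V"]) auto
  qed
  then show ?thesis by (simp add: continuous_at_imp_continuous_on)
qed

section \<open>The inversion formula\<close>

lemma integrable_compact_support:
  fixes f :: "'a \<Rightarrow> 'b::{banach, second_countable_topology}"
  assumes f: "continuous_on UNIV f" and K: "compact K" and f0: "\<And>x. x \<notin> K \<Longrightarrow> f x = 0"
  shows "integrable M f"
proof -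
  have "compact (f ` K)"
    using K f by (intro compact_continuous_image) (auto intro: continuous_on_subset)
  then obtain B where "\<forall>x\<in>f ` K. norm x \<le> B"
    using compact_imp_bounded bounded_iff by blast
  then show ?thesis
    using K emeasure_compact[OF K] f0
    by (intro integrableI_bounded_set[of K _ _ B]) (auto simp: borel_set continuous_measurable[OF f])
qed

lemma integral_close:
  fixes f g :: "'a \<Rightarrow> real"
  assumes fg: "integrable M f" "integrable M g" and L: "compact L"
    and le: "\<And>x. x \<in> L \<Longrightarrow> \<bar>f x - g x\<bar> \<le> e" and 0: "\<And>x. x \<notin> L \<Longrightarrow> f x = 0 \<and> g x = 0"
  shows "\<bar>(\<integral>x. f x \<partial>M) - (\<integral>x. g x \<partial>M)\<bar> \<le> e * measure M L"
proof -
  have "\<bar>(\<integral>x. f x \<partial>M) - (\<integral>x. g x \<partial>M)\<bar> = \<bar>\<integral>x. f x - g x \<partial>M\<bar>"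
    using fg by simp
  also have "\<dots> \<le> (\<integral>x. \<bar>f x - g x\<bar> \<partial>M)"
    by (rule integral_abs_bound)
  also have "\<dots> \<le> (\<integral>x. e * indicator L x \<partial>M)"
    using fg L emeasure_compact[OF L] le 0
    by (intro integral_mono integrable_mult_right integrable_abs Bochner_Integration.integrable_diff)
      (auto simp: borel_set split: split_indicator)
  finally show ?thesis using L by (simp add: borel_set)
qed

text \<open>Compactness of \<open>L\<close> makes the sections of \<open>F\<close> at points near
  \<open>s\<close> uniformly close on \<open>L\<close>, and a uniform error on a set of finite
  measure gives a small error of the integral.\<close>

lemma continuous_partial_integral:
  fixes F :: "'a \<times> 'a \<Rightarrow> real"
  assumes F: "continuous_on UNIV F" and L: "compact L" and F0: "\<And>s t. t \<notin> L \<Longrightarrow> F (s, t) = 0"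
  shows "continuous_on UNIV (\<lambda>s. \<integral>t. F (s, t) \<partial>M)"
proof -
  have int: "integrable M (\<lambda>t. F (s, t))" for s
    by (rule integrable_compact_support[OF _ L])
      (auto simp: F0 intro!: continuous_intros continuous_on_compose2[OF F])
  have "isCont (\<lambda>s. \<integral>t. F (s, t) \<partial>M) s" for s
    unfolding isCont_def
  proof (rule tendstoI)
    fix e :: real assume e: "e > 0"
    \<comment> \<open>The added 1 keeps the divisor positive even if \<open>L\<close> is a null
      set.\<close>
    define p where "p = measure M L + 1"
    have p: "p > 0" by (simp add: p_def add_nonneg_pos)
    define d where "d = e / (2 * p)"
    have d: "d > 0" using e p by (simp add: d_def)
    obtain X where X: "s \<in> X" "open X"
      and le: "\<forall>x\<in>X \<inter> UNIV. \<forall>t\<in>L. dist (F (x, t)) (F (s, t)) \<le> d"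
      using continuous_on_prod_compactE[OF continuous_on_subset[OF F subset_UNIV] L UNIV_I d]
      by (metis Sigma_cong UNIV_I)
    have "dist (\<integral>t. F (x, t) \<partial>M) (\<integral>t. F (s, t) \<partial>M) < e" if "x \<in> X" for x
    proof -
      have "dist (\<integral>t. F (x, t) \<partial>M) (\<integral>t. F (s, t) \<partial>M) \<le> d * measure M L"
        unfolding dist_real_def
        using le that by (intro integral_close int L) (auto simp: F0 dist_real_def)
      also have "\<dots> \<le> d * p" using d by (simp add: p_def)
      also have "\<dots> < e" using e p by (simp add: d_def)
      finally show ?thesis .
    qed
    then show "\<forall>\<^sub>F x in at s. dist (\<integral>t. F (x, t) \<partial>M) (\<integral>t. F (s, t) \<partial>M) < e"
      unfolding eventually_at_topological using X by blast
  qed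
  then show ?thesis by (simp add: continuous_at_imp_continuous_on)
qed

text \<open>The library's Fubini theorem needs sigma-finite measures and the product sigma-algebra, which
  can be smaller than the Borel sets of the product. For compact support, step functions in the first
  variable that approximate the integrand uniformly suffice.\<close>

lemma Fubini_compact_support:
  fixes F :: "'a \<times> 'a \<Rightarrow> real"
  assumes F: "continuous_on UNIV F" and K: "compact K" and L: "compact L"
    and FK: "\<And>s t. s \<notin> K \<Longrightarrow> F (s, t) = 0" and FL: "\<And>s t. t \<notin> L \<Longrightarrow> F (s, t) = 0"
  shows "(\<integral>s. (\<integral>t. F (s, t) \<partial>M) \<partial>M) = (\<integral>t. (\<integral>s. F (s, t) \<partial>M) \<partial>M)"
proof -
  define G where "G s = (\<integral>t. F (s, t) \<partial>M)" for s
  define H where "H t = (\<integral>s. F (s, t) \<partial>M)" for t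
  let ?m = "measure M K" and ?n = "measure M L"
  have swap: "continuous_on UNIV (\<lambda>(t, s). F (s, t))"
    by (auto simp: case_prod_unfold intro!: continuous_intros continuous_on_compose2[OF F])
  have intL: "integrable M (\<lambda>t. F (s, t))" for s
    by (rule integrable_compact_support[OF _ L])
      (auto simp: FL intro!: continuous_intros continuous_on_compose2[OF F])
  have intK: "integrable M (\<lambda>s. F (s, t))" for t
    by (rule integrable_compact_support[OF _ K])
      (auto simp: FK intro!: continuous_intros continuous_on_compose2[OF F])
  have G0: "G s = 0" if "s \<notin> K" for s using FK[OF that] by (simp add: G_def)
  have H0: "H t = 0" if "t \<notin> L" for t using FL[OF that] by (simp add: H_def)
  have intG: "integrable M G"
    using continuous_partial_integral[OF F L FL]
    by (intro integrable_compact_support[OF _ K]) (auto simp: G_def[abs_def] FK)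
  have intH: "integrable M H"
    using continuous_partial_integral[OF swap K] FK
    by (intro integrable_compact_support[OF _ L]) (auto simp: H_def[abs_def] FL)
  have close: "\<bar>integral\<^sup>L M G - integral\<^sup>L M H\<bar> \<le> e * (2 * (?m * ?n))" if e: "e > 0" for e
  proof -
    \<comment> \<open>Near \<open>s\<close> the sections of \<open>F\<close> differ by at most
      \<open>e\<close> for all \<open>t\<close> in \<open>L\<close> at once; finitely many such
      neighbourhoods cover \<open>K\<close>.\<close>
    have "\<exists>X. s \<in> X \<and> open X \<and> (\<forall>x\<in>X. \<forall>t\<in>L. \<bar>F (x, t) - F (s, t)\<bar> \<le> e)" for s
      using continuous_on_prod_compactE[OF continuous_on_subset[OF F subset_UNIV] L UNIV_I e, of s]
      by (metis Int_UNIV_right dist_real_def)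
    then have "\<forall>s. \<exists>X. s \<in> X \<and> open X \<and> (\<forall>x\<in>X. \<forall>t\<in>L. \<bar>F (x, t) - F (s, t)\<bar> \<le> e)" ..
    from choice[OF this] obtain X
      where X: "\<forall>s. s \<in> X s \<and> open (X s) \<and> (\<forall>x\<in>X s. \<forall>t\<in>L. \<bar>F (x, t) - F (s, t)\<bar> \<le> e)" ..
    have oX: "\<And>s. s \<in> K \<Longrightarrow> open (X s)" and "K \<subseteq> (\<Union>s\<in>K. X s)" using X by auto
    then obtain T where T: "T \<subseteq> K" "finite T" "K \<subseteq> (\<Union>s\<in>T. X s)"
      by (rule compactE_image[OF K])
    obtain f :: "nat \<Rightarrow> 'a" and n where f: "T = f ` {i. i < n}"
      using finite_imp_nat_seg_image_inj_on[OF T(2)] by blast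
    \<comment> \<open>Listing the finite cover as a sequence that is empty from \<open>n\<close> on
      lets \<open>disjointed\<close> cut \<open>K\<close> into measurable pieces \<open>D i\<close>,
      on each of which \<open>F\<close> is within \<open>e\<close> of its section at
      \<open>f i\<close>.\<close>
    define A where "A i = (if i < n then K \<inter> X (f i) else {})" for i
    define D where "D = disjointed A"
    have sA: "range A \<subseteq> sets M"
      using X K by (auto simp: A_def borel_set)
    have sD: "D i \<in> sets M" for i
      using sets.range_disjointed_sets[OF sA] by (auto simp: D_def)
    have DA: "D i \<subseteq> A i" for i
      by (simp add: D_def disjointed_subset)
    have DK: "D i \<subseteq> K" for i
      using DA[of i] by (auto simp: A_def split: if_splits)
    have fin: "emeasure M (D i) < \<infinity>" for i
      using emeasure_mono[OF DK borel_set(3)[OF K], of i] emeasure_compact[OF K]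
      by (rule order.strict_trans1)
    have UD: "K = (\<Union>i. D i)"
      unfolding D_def UN_disjointed_eq using T(3) f by (auto simp: A_def split: if_splits)
    have disj: "disjoint_family D"
      by (simp add: D_def disjoint_family_disjointed)
    define P where "P c x = (\<Sum>i<n. indicator (D i) x * c i)" for c :: "nat \<Rightarrow> real" and x
    have P_out: "P c x = 0" if "x \<notin> K" for c x
      using that DK by (auto simp: P_def indicator_def intro!: sum.neutral)
    have P_in: "\<exists>i<n. x \<in> X (f i) \<and> (\<forall>c. P c x = c i)" if x: "x \<in> K" for x
    proof -
      obtain i where i: "x \<in> D i" using x UD by blast
      with DA[of i] have "i < n" "x \<in> X (f i)" by (auto simp: A_def split: if_splits)
      moreover have "P c x = c i" for c
      proof -
        have "indicator (D j) x * c j = (if j = i then c j else 0)" for j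
          using disj i by (auto simp: disjoint_family_on_def indicator_def)
        then show ?thesis using \<open>i < n\<close> by (simp add: P_def)
      qed
      ultimately show ?thesis by blast
    qed
    have intP: "integrable M (P c)" for c
      unfolding P_def[abs_def] using sD fin
      by (intro Bochner_Integration.integrable_sum integrable_mult_left) simp
    have integralP: "(\<integral>x. P c x \<partial>M) = (\<Sum>i<n. measure M (D i) * c i)" for c
      unfolding P_def using sD fin
      by (subst Bochner_Integration.integral_sum) (auto intro!: integrable_mult_left)
    have G_close: "\<bar>integral\<^sup>L M G - (\<integral>x. P (\<lambda>i. G (f i)) x \<partial>M)\<bar> \<le> (e * ?n) * ?m"
    proof (rule integral_close[OF intG intP K])
      fix x assume "x \<in> K"
      then obtain i where i: "i < n" "x \<in> X (f i)" "\<And>c. P c x = c i" using P_in by blast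
      show "\<bar>G x - P (\<lambda>i. G (f i)) x\<bar> \<le> e * ?n"
        unfolding i(3) unfolding G_def
        using X i(2) FL by (intro integral_close intL L) auto
    qed (simp add: G0 P_out)
    have H_close: "\<bar>integral\<^sup>L M H - (\<integral>t. \<integral>x. P (\<lambda>i. F (f i, t)) x \<partial>M \<partial>M)\<bar> \<le> (e * ?m) * ?n"
    proof (rule integral_close[OF intH _ L])
      show "integrable M (\<lambda>t. \<integral>x. P (\<lambda>i. F (f i, t)) x \<partial>M)"
        unfolding integralP by (intro Bochner_Integration.integrable_sum integrable_mult_right intL)
    next
      fix t assume t: "t \<in> L"
      show "\<bar>H t - (\<integral>x. P (\<lambda>i. F (f i, t)) x \<partial>M)\<bar> \<le> e * ?m"
        unfolding H_def
      proof (rule integral_close[OF intK intP K])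
        fix x assume "x \<in> K"
        then obtain i where i: "i < n" "x \<in> X (f i)" "\<And>c. P c x = c i" using P_in by blast
        show "\<bar>F (x, t) - P (\<lambda>i. F (f i, t)) x\<bar> \<le> e"
          unfolding i(3) using X i(2) t by auto
      qed (simp add: FK P_out)
    next
      fix t assume "t \<notin> L"
      then show "H t = 0 \<and> (\<integral>x. P (\<lambda>i. F (f i, t)) x \<partial>M) = 0"
        by (simp add: H0 integralP FL)
    qed
    \<comment> \<open>For step functions in the first variable the exchange is linearity of the
      integral over a finite sum.\<close>
    have "(\<integral>t. \<integral>x. P (\<lambda>i. F (f i, t)) x \<partial>M \<partial>M) = (\<integral>x. P (\<lambda>i. G (f i)) x \<partial>M)"
      unfolding integralP G_def
      by (subst Bochner_Integration.integral_sum) (auto intro!: integrable_mult_right intL)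
    with G_close H_close show ?thesis by (simp add: algebra_simps)
  qed
  have "\<bar>integral\<^sup>L M G - integral\<^sup>L M H\<bar> \<le> 0"
  proof (rule field_le_epsilon)
    fix e :: real assume e: "e > 0"
    define d where "d = e / (2 * (?m * ?n) + 1)"
    have c: "2 * (?m * ?n) \<ge> 0" by simp
    then have "d > 0" using e by (simp add: d_def add_nonneg_pos)
    then have "\<bar>integral\<^sup>L M G - integral\<^sup>L M H\<bar> \<le> d * (2 * (?m * ?n))" by (rule close)
    also have "\<dots> \<le> d * (2 * (?m * ?n) + 1)" using \<open>d > 0\<close> by simp
    also have "\<dots> = e" unfolding d_def using add_nonneg_pos[OF c zero_less_one] by simp
    finally show "\<bar>integral\<^sup>L M G - integral\<^sup>L M H\<bar> \<le> 0 + e" by simp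
  qed
  then show ?thesis by (simp add: G_def[abs_def] H_def[abs_def])
qed

text \<open>Integrate \<open>f s * k (- t + s)\<close> in both orders, for \<open>f\<close> with nonzero integral; the
  substitution \<open>s \<mapsto> t + s\<close> and a second exchange produce the modular function.\<close>

lemma integral_inverse_compact_support:
  fixes k :: "'a \<Rightarrow> real"
  assumes k: "continuous_on UNIV k" and C: "compact C" and k0: "\<And>x. x \<notin> C \<Longrightarrow> k x = 0"
  shows "(\<integral>t. k (- t) \<partial>M) = (\<integral>s. k s * \<delta> (- s) \<partial>M)"
proof -
  obtain K where K: "compact K" "0 < measure M K" "emeasure M K = ennreal (measure M K)"
    using compact_positive .
  obtain f B where f: "continuous_on UNIV f" "\<And>x. 0 \<le> f x" "\<And>x. x \<in> K \<Longrightarrow> f x = (1::real)"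
    and B: "compact B" "\<And>x. x \<notin> B \<Longrightarrow> f x = 0"
    using Urysohn_compact[OF K(1)] by metis
  have int_f: "integrable M f" by (rule integrable_compact_support[OF f(1) B])
  have "(\<integral>x. indicator K x \<partial>M) \<le> (\<integral>x. f x \<partial>M)"
    using K int_f f by (intro integral_mono) (auto simp: borel_set split: split_indicator)
  then have f_pos: "0 < (\<integral>x. f x \<partial>M)"
    using K by (simp add: borel_set)
  \<comment> \<open>In the first exchange \<open>s\<close> lies in \<open>B\<close> and
    \<open>- t + s\<close> in \<open>C\<close>, in the second \<open>t + s\<close> lies in
    \<open>B\<close> and \<open>s\<close> in \<open>C\<close>. Either way \<open>t\<close> is an
    element of \<open>B\<close> minus one of \<open>C\<close>, so the same compact set bounds
    \<open>t\<close> in both.\<close>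
  define L where "L = (\<lambda>(s, c). s + - c) ` (B \<times> C)"
  have L: "compact L"
    unfolding L_def using B(1) C
    by (intro compact_continuous_image compact_Times) (auto simp: case_prod_unfold intro!: continuous_intros)
  have m: "k \<in> borel_measurable M" by (rule continuous_measurable[OF k])
  have "(\<integral>s. f s * (\<integral>t. k (- t) \<partial>M) \<partial>M) = (\<integral>s. (\<integral>t. f s * k (- t + s) \<partial>M) \<partial>M)"
  proof (rule Bochner_Integration.integral_cong[OF refl])
    fix s
    have "continuous_on UNIV (\<lambda>t. k (- t + s))"
      by (intro continuous_on_compose2[OF k] continuous_intros) auto
    \<comment> \<open>Substituting \<open>s + t\<close> for \<open>t\<close> turns
      \<open>k (- t + s)\<close> into \<open>k (- t)\<close>.\<close>
    from integral_left[OF continuous_measurable[OF this], of s]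
    show "f s * (\<integral>t. k (- t) \<partial>M) = (\<integral>t. f s * k (- t + s) \<partial>M)"
      by (simp add: minus_add add.assoc)
  qed
  also have "\<dots> = (\<integral>t. (\<integral>s. f s * k (- t + s) \<partial>M) \<partial>M)"
  proof -
    have "f s * k (- t + s) = 0" if "t \<notin> L" for s t
    proof (rule ccontr)
      assume "f s * k (- t + s) \<noteq> 0"
      then have "s \<in> B" "- t + s \<in> C" using B k0 by force+
      then have "s + - (- t + s) \<in> L" by (auto simp: L_def)
      moreover have "s + - (- t + s) = t" by (simp only: minus_add minus_minus add_minus_cancel)
      ultimately show False using that by simp
    qed
    moreover have "continuous_on UNIV (\<lambda>(s, t). f s * k (- t + s))"
      unfolding case_prod_unfold
      by (intro continuous_intros continuous_on_compose2[OF k] continuous_on_compose2[OF f(1)]) auto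
    ultimately show ?thesis
      using Fubini_compact_support[of "\<lambda>(s, t). f s * k (- t + s)" B L] B L by simp
  qed
  also have "\<dots> = (\<integral>t. (\<integral>s. f (t + s) * k s \<partial>M) \<partial>M)"
  proof (rule Bochner_Integration.integral_cong[OF refl])
    fix t
    have "continuous_on UNIV (\<lambda>s. f s * k (- t + s))"
      by (intro continuous_on_compose2[OF k] continuous_intros f) auto
    from integral_left[OF continuous_measurable[OF this], of t]
    show "(\<integral>s. f s * k (- t + s) \<partial>M) = (\<integral>s. f (t + s) * k s \<partial>M)"
      by simp
  qed
  also have "\<dots> = (\<integral>s. (\<integral>t. f (t + s) * k s \<partial>M) \<partial>M)"
  proof -
    have "f (t + s) * k s = 0" if "t \<notin> L" for s t
    proof (rule ccontr)
      assume "f (t + s) * k s \<noteq> 0"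
      then have "t + s \<in> B" "s \<in> C" using B k0 by force+
      then have "(t + s) + - s \<in> L" unfolding L_def by (intro image_eqI[of _ _ "(t + s, s)"]) simp_all
      then show False using that by simp
    qed
    moreover have "continuous_on UNIV (\<lambda>(t, s). f (t + s) * k s)"
      unfolding case_prod_unfold
      by (intro continuous_intros continuous_on_compose2[OF k] continuous_on_compose2[OF f(1)]) auto
    ultimately show ?thesis
      using Fubini_compact_support[of "\<lambda>(t, s). f (t + s) * k s" L C] C L k0 by simp
  qed
  \<comment> \<open>The inner integral is that of \<open>f\<close> translated on the right by
    \<open>s\<close>, and this is where the modular function enters.\<close>
  also have "\<dots> = (\<integral>s. k s * \<delta> (- s) * (\<integral>t. f t \<partial>M) \<partial>M)"
    using integral_right[OF continuous_measurable[OF f(1)] f(2)]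
    by (intro Bochner_Integration.integral_cong refl) (simp add: ac_simps)
  finally have "(\<integral>x. f x \<partial>M) * (\<integral>t. k (- t) \<partial>M) = (\<integral>x. f x \<partial>M) * (\<integral>s. k s * \<delta> (- s) \<partial>M)"
    by (simp add: mult.commute)
  then show ?thesis using f_pos by simp
qed


section \<open>Inversion for integrable continuous functions\<close>

text \<open>Reduces a bound on the integral of \<open>F\<close> to compactly supported minorants
  without sigma-compactness. If some level set \<open>F > c\<close> with \<open>c > 0\<close> has
  infinite measure, inner regularity forces \<open>b\<close> to be infinite. Otherwise each level
  set above \<open>1 / Suc n\<close> is a countable union of compact sets up to a null set, and
  monotone convergence applies.\<close>

lemma nn_integral_le_compact_support:
  fixes F :: "'a \<Rightarrow> real"
  assumes F: "continuous_on UNIV F" "\<And>x. 0 \<le> F x"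
    and le: "\<And>h K. continuous_on UNIV h \<Longrightarrow> (\<And>x. 0 \<le> h x \<and> h x \<le> F x) \<Longrightarrow> compact K \<Longrightarrow>
      (\<And>x. x \<notin> K \<Longrightarrow> h x = 0) \<Longrightarrow> (\<integral>\<^sup>+x. ennreal (h x) \<partial>M) \<le> b"
  shows "(\<integral>\<^sup>+x. ennreal (F x) \<partial>M) \<le> b"
proof -
  have [measurable]: "F \<in> borel_measurable M" by (rule continuous_measurable[OF F(1)])
  have on_compact: "(\<integral>\<^sup>+x. ennreal (F x) * indicator K x \<partial>M) \<le> b" if K: "compact K" for K
  proof -
    obtain u L where u: "continuous_on UNIV u" "\<And>x. 0 \<le> u x" "\<And>x. u x \<le> (1::real)"
      "\<And>x. x \<in> K \<Longrightarrow> u x = 1" and L: "compact L" "\<And>x. x \<notin> L \<Longrightarrow> u x = 0"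
      using Urysohn_compact[OF K] by metis
    \<comment> \<open>The product of \<open>F\<close> with a Urysohn function for \<open>K\<close>
      is a minorant of the kind allowed in \<open>le\<close> and agrees with \<open>F\<close> on
      \<open>K\<close>.\<close>
    have "(\<integral>\<^sup>+x. ennreal (F x) * indicator K x \<partial>M) \<le> (\<integral>\<^sup>+x. ennreal (F x * u x) \<partial>M)"
      using u F by (intro nn_integral_mono) (auto split: split_indicator)
    also have "\<dots> \<le> b"
      using u L F mult_left_mono[OF u(3) F(2)] by (intro le[of _ L] continuous_intros) auto
    finally show ?thesis .
  qed
  define U where "U c = {x. c < F x}" for c
  have oU: "open (U c)" for c
    unfolding U_def using F(1) by (intro open_Collect_less continuous_intros)
  show ?thesis
  proof (cases "\<exists>c>0. emeasure M (U c) = \<infinity>")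
    case True
    then obtain c where c: "c > 0" "emeasure M (U c) = \<infinity>" by blast
    have "ennreal c * emeasure M K \<le> b" if K: "compact K" "K \<subseteq> U c" for K
    proof -
      have "ennreal c * emeasure M K = (\<integral>\<^sup>+x. ennreal c * indicator K x \<partial>M)"
        using K by (simp add: nn_integral_cmult_indicator borel_set)
      also have "\<dots> \<le> (\<integral>\<^sup>+x. ennreal (F x) * indicator K x \<partial>M)"
        using K(2) by (intro nn_integral_mono) (auto simp: U_def less_imp_le intro!: ennreal_leI split: split_indicator)
      also note on_compact[OF K(1)]
      finally show ?thesis .
    qed
    then have "(SUP K\<in>{K. compact K \<and> K \<subseteq> U c}. ennreal c * emeasure M K) \<le> b"
      by (intro SUP_least) auto
    moreover have "(SUP K\<in>{K. compact K \<and> K \<subseteq> U c}. ennreal c * emeasure M K) = ennreal c * emeasure M (U c)"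
      unfolding inner_regular[OF oU]
      by (intro SUP_mult_left_ennreal[symmetric])
    ultimately show ?thesis
      using c by (simp add: ennreal_mult_top top_unique)
  next
    case False
    have "\<exists>K :: nat \<Rightarrow> 'a set. (\<forall>i. compact (K i) \<and> K i \<subseteq> U c) \<and> (SUP i. emeasure M (K i)) = emeasure M (U c)" for c
    proof -
      have "{K. compact K \<and> K \<subseteq> U c} \<noteq> {}" by (auto intro: exI[of _ "{}"])
      from ennreal_SUP_countable_SUP[OF this, of "emeasure M"] obtain m :: "nat \<Rightarrow> ennreal"
        where m: "range m \<subseteq> emeasure M ` {K. compact K \<and> K \<subseteq> U c}"
          "(SUP K\<in>{K. compact K \<and> K \<subseteq> U c}. emeasure M K) = (SUP i. m i)"
        by auto
      then have "\<forall>i. \<exists>K. compact K \<and> K \<subseteq> U c \<and> m i = emeasure M K" by (auto simp: image_iff subset_iff)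
      from choice[OF this] obtain K where "\<forall>i. compact (K i) \<and> K i \<subseteq> U c \<and> m i = emeasure M (K i)" ..
      with m inner_regular[OF oU, of c] show ?thesis by (intro exI[of _ K]) simp
    qed
    then have "\<forall>n. \<exists>K :: nat \<Rightarrow> 'a set. (\<forall>i. compact (K i) \<and> K i \<subseteq> U (1 / Suc n)) \<and>
      (SUP i. emeasure M (K i)) = emeasure M (U (1 / Suc n))" by blast
    from choice[OF this] obtain K :: "nat \<Rightarrow> nat \<Rightarrow> 'a set"
      where "\<forall>n. (\<forall>i. compact (K n i) \<and> K n i \<subseteq> U (1 / Suc n)) \<and>
      (SUP i. emeasure M (K n i)) = emeasure M (U (1 / Suc n))" ..
    then have K: "\<And>n i. compact (K n i)" "\<And>n i. K n i \<subseteq> U (1 / Suc n)"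
      and SUP: "\<And>n. (SUP i. emeasure M (K n i)) = emeasure M (U (1 / Suc n))" by blast+
    have null: "U (1 / Suc n) - (\<Union>i. K n i) \<in> null_sets M" for n
    proof -
      have sK: "(\<Union>i. K n i) \<in> sets M" using K borel_set by (intro sets.countable_UN) auto
      have sub: "(\<Union>i. K n i) \<subseteq> U (1 / Suc n)" using K(2) by (rule UN_least)
      have "emeasure M (\<Union>i. K n i) = emeasure M (U (1 / Suc n))"
      proof (rule antisym)
        show "emeasure M (U (1 / Suc n)) \<le> emeasure M (\<Union>i. K n i)"
          unfolding SUP[symmetric] using sK by (intro SUP_least emeasure_mono) auto
      qed (intro emeasure_mono sub borel_set(1) oU)
      \<comment> \<open>Finite measure of the level set is what turns equality of measures into a
        null difference.\<close>
      moreover have "emeasure M (U (1 / Suc n)) \<noteq> \<infinity>" using False by auto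
      ultimately have "emeasure M (U (1 / Suc n) - (\<Union>i. K n i)) = 0"
        using sub sK oU by (subst emeasure_Diff) (auto intro: borel_set(1))
      then show ?thesis using sK oU by (auto intro: borel_set(1))
    qed
    \<comment> \<open>Cutting off both indices at \<open>j\<close> makes the compact sets increase,
      and their union is still that of all \<open>K n i\<close>.\<close>
    define D where "D j = (\<Union>n\<le>j. \<Union>i\<le>j. K n i)" for j
    have cD: "compact (D j)" for j
      unfolding D_def using K(1) by (intro compact_UN) auto
    have "AE x in M. \<forall>n. x \<notin> U (1 / Suc n) - (\<Union>i. K n i)"
      unfolding AE_all_countable by (intro allI AE_not_in null)
    then have "AE x in M. ennreal (F x) = (SUP j. ennreal (F x) * indicator (D j) x)"
    proof eventually_elim
      case (elim x)
      show ?case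
      proof (cases "F x = 0")
        case True
        then show ?thesis by simp
      next
        case False
        with F(2)[of x] have "F x > 0" by simp
        then obtain n where "1 / Suc n < F x" using nat_approx_posE by metis
        with elim obtain i where "x \<in> K n i" by (auto simp: U_def)
        then have "x \<in> D (max n i)"
          unfolding D_def by (intro UN_I[of n] UN_I[of i]) auto
        then have "ennreal (F x) \<le> (SUP j. ennreal (F x) * indicator (D j) x)"
          by (intro SUP_upper2[of "max n i"]) auto
        then show ?thesis
          by (intro antisym SUP_least) (auto split: split_indicator)
      qed
    qed
    then have "(\<integral>\<^sup>+x. ennreal (F x) \<partial>M) = (\<integral>\<^sup>+x. (SUP j. ennreal (F x) * indicator (D j) x) \<partial>M)"
      by (rule nn_integral_cong_AE)
    also have "\<dots> = (SUP j. (\<integral>\<^sup>+x. ennreal (F x) * indicator (D j) x \<partial>M))"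
    proof (rule nn_integral_monotone_convergence_SUP)
      have "D i \<subseteq> D j" if "i \<le> j" for i j
        using that unfolding D_def by (intro UN_mono) auto
      then show "incseq (\<lambda>j x. ennreal (F x) * indicator (D j) x)"
        by (auto simp: incseq_def le_fun_def split: split_indicator)
    qed (use cD borel_set in measurable)
    also have "\<dots> \<le> b" using cD on_compact by (intro SUP_least) auto
    finally show ?thesis .
  qed
qed

text \<open>Passing from \<open>F\<close> to \<open>\<lambda>x. F (- x) * \<delta> (- x)\<close> is
  an involution, since \<open>\<delta> (- x) * \<delta> x = 1\<close>. Hence one inequality, applied
  also to the transformed function, gives equality.\<close>

lemma nn_integral_inverse:
  fixes F :: "'a \<Rightarrow> real"
  assumes F: "continuous_on UNIV F" "\<And>x. 0 \<le> F x"
  shows "(\<integral>\<^sup>+x. ennreal (F (- x) * \<delta> (- x)) \<partial>M) = (\<integral>\<^sup>+x. ennreal (F x) \<partial>M)"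
proof -
  have cont: "continuous_on UNIV (\<lambda>x. F (- x) * \<delta> (- x))" if F: "continuous_on UNIV F" for F
    by (intro continuous_intros continuous_on_compose2[OF F] continuous_on_compose2[OF delta_continuous]) auto
  have le: "(\<integral>\<^sup>+x. ennreal (F x) \<partial>M) \<le> (\<integral>\<^sup>+x. ennreal (F (- x) * \<delta> (- x)) \<partial>M)"
    if F: "continuous_on UNIV F" "\<And>x. 0 \<le> F x" for F
  proof (rule nn_integral_le_compact_support[OF F])
    fix h K assume h: "continuous_on UNIV h" "\<And>x. 0 \<le> h x \<and> h x \<le> F x"
      and K: "compact K" "\<And>x. x \<notin> K \<Longrightarrow> h x = 0"
    \<comment> \<open>The formula for compact support is used for \<open>h\<close> times
      \<open>\<delta>\<close>, so that the weight it produces cancels.\<close>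
    have "(\<integral>x. h (- x) * \<delta> (- x) \<partial>M) = (\<integral>x. h x * \<delta> x * \<delta> (- x) \<partial>M)"
      using integral_inverse_compact_support[of "\<lambda>x. h x * \<delta> x" K] h K
      by (auto intro!: continuous_intros delta_continuous)
    then have eq: "(\<integral>x. h x \<partial>M) = (\<integral>x. h (- x) * \<delta> (- x) \<partial>M)"
      by (simp add: delta_minus mult.assoc)
    have "compact (uminus ` K)"
      using K(1) by (intro compact_continuous_image continuous_intros)
    then have "integrable M (\<lambda>x. h (- x) * \<delta> (- x))"
      using K(2) by (intro integrable_compact_support[OF cont[OF h(1)]])
        (auto simp: image_iff, metis minus_minus)
    then have "(\<integral>\<^sup>+x. ennreal (h x) \<partial>M) = (\<integral>\<^sup>+x. ennreal (h (- x) * \<delta> (- x)) \<partial>M)"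
      using eq integrable_compact_support[OF h(1) K] h(2) by (simp add: nn_integral_eq_integral)
    also have "\<dots> \<le> (\<integral>\<^sup>+x. ennreal (F (- x) * \<delta> (- x)) \<partial>M)"
      using h(2) by (intro nn_integral_mono ennreal_leI mult_right_mono) auto
    finally show "(\<integral>\<^sup>+x. ennreal (h x) \<partial>M) \<le> (\<integral>\<^sup>+x. ennreal (F (- x) * \<delta> (- x)) \<partial>M)" .
  qed
  show ?thesis
    using le[OF F] le[OF cont[OF F(1)]] F(2) by (simp add: mult.assoc delta_minus)
qed

lemma integrable_inverse:
  fixes F :: "'a \<Rightarrow> 'b::{real_normed_vector, second_countable_topology, banach}"
  assumes F: "continuous_on UNIV F" "integrable M F"
  shows "integrable M (\<lambda>x. \<delta> (- x) *\<^sub>R F (- x))"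
proof (rule integrableI_bounded)
  show "(\<lambda>x. \<delta> (- x) *\<^sub>R F (- x)) \<in> borel_measurable M"
    by (intro continuous_measurable continuous_intros continuous_on_compose2[OF F(1)]
          continuous_on_compose2[OF delta_continuous]) auto
  have "(\<integral>\<^sup>+x. ennreal (norm (\<delta> (- x) *\<^sub>R F (- x))) \<partial>M) = (\<integral>\<^sup>+x. ennreal (norm (F x)) \<partial>M)"
    using nn_integral_inverse[of "\<lambda>x. norm (F x)"] F(1)
    by (simp add: mult.commute continuous_on_norm)
  then show "(\<integral>\<^sup>+x. ennreal (norm (\<delta> (- x) *\<^sub>R F (- x))) \<partial>M) < \<infinity>"
    using F(2) by (simp add: integrable_iff_bounded)
qed

text \<open>\<open>ennreal\<close> sends negative numbers to 0, so the formula for nonnegative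
  functions yields one for the positive parts of \<open>F\<close> and of \<open>- F\<close>, and the
  integral of \<open>F\<close> is the difference of the two.\<close>

lemma integral_inverse_real:
  fixes F :: "'a \<Rightarrow> real"
  assumes F: "continuous_on UNIV F" "integrable M F"
  shows "(\<integral>x. \<delta> (- x) * F (- x) \<partial>M) = (\<integral>x. F x \<partial>M)"
proof -
  have "(\<integral>\<^sup>+x. ennreal (\<delta> (- x) * F (- x)) \<partial>M) = (\<integral>\<^sup>+x. ennreal (F x) \<partial>M)"
    if F: "continuous_on UNIV F" for F
  proof -
    have "(\<integral>\<^sup>+x. ennreal (max 0 (F (- x)) * \<delta> (- x)) \<partial>M) = (\<integral>\<^sup>+x. ennreal (max 0 (F x)) \<partial>M)"
      using F by (intro nn_integral_inverse continuous_intros) auto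
    moreover have "ennreal (max 0 y * d) = ennreal (d * y)" if "0 < d" for y d :: real
      using that by (cases "0 \<le> y") (auto simp: max_def mult.commute ennreal_neg mult_nonneg_nonpos)
    moreover have "ennreal (max 0 y) = ennreal y" for y :: real
      by (simp add: max_def ennreal_neg)
    ultimately show ?thesis by simp
  qed
  from this[OF F(1)] this[of "\<lambda>x. - F x"] show ?thesis
    using integrable_inverse[OF F] F
    by (simp add: real_lebesgue_integral_def continuous_on_minus)
qed

lemma integral_inverse:
  fixes F :: "'a \<Rightarrow> complex"
  assumes F: "continuous_on UNIV F" "integrable M F"
  shows "(\<integral>x. complex_of_real (\<delta> (- x)) * F (- x) \<partial>M) = (\<integral>x. F x \<partial>M)"
proof (rule complex_eqI)
  have int: "integrable M (\<lambda>x. complex_of_real (\<delta> (- x)) * F (- x))"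
    using integrable_inverse[OF F] by (simp add: scaleR_conv_of_real)
  show "Re (\<integral>x. complex_of_real (\<delta> (- x)) * F (- x) \<partial>M) = Re (\<integral>x. F x \<partial>M)"
    using integral_inverse_real[of "\<lambda>x. Re (F x)"] F integral_Re[OF int] by (simp add: continuous_on_Re)
  show "Im (\<integral>x. complex_of_real (\<delta> (- x)) * F (- x) \<partial>M) = Im (\<integral>x. F x \<partial>M)"
    using integral_inverse_real[of "\<lambda>x. Im (F x)"] F integral_Im[OF int] by (simp add: continuous_on_Im)
qed

end

section \<open>The Hilbert space of square integrable functions\<close>

lemma borel_measurable_cnj [measurable]:
  "f \<in> borel_measurable M \<Longrightarrow> (\<lambda>x. cnj (f x)) \<in> borel_measurable M"
  by (rule borel_measurable_continuous_on[of cnj]) (intro continuous_intros)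

lemma L2_measurable [measurable_dest]: "f \<in> L2 M \<Longrightarrow> f \<in> borel_measurable M"
  by (simp add: L2_def)

lemma L2_integrable: "f \<in> L2 M \<Longrightarrow> integrable M (\<lambda>x. (cmod (f x))\<^sup>2)"
  by (simp add: L2_def)

lemma L2_bound:
  assumes "f \<in> borel_measurable M" "integrable M g" "\<And>x. (cmod (f x))\<^sup>2 \<le> g x"
  shows "f \<in> L2 M"
  using assms(1) unfolding L2_def
  by (auto intro!: Bochner_Integration.integrable_bound[OF assms(2)] assms(3)[THEN order_trans] AE_I2)

lemma L2_cmult: "f \<in> L2 M \<Longrightarrow> (\<lambda>x. c * f x) \<in> L2 M"
  by (auto simp: L2_def norm_mult power_mult_distrib)

lemma cmod_add_sq_le: "(cmod (a + b))\<^sup>2 \<le> 2 * (cmod a)\<^sup>2 + 2 * (cmod b)\<^sup>2"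
proof -
  have "(cmod (a + b))\<^sup>2 \<le> (cmod a + cmod b)\<^sup>2"
    by (intro power_mono norm_triangle_ineq) simp
  also have "\<dots> \<le> 2 * (cmod a)\<^sup>2 + 2 * (cmod b)\<^sup>2"
    using sum_squares_bound[of "cmod a" "cmod b"] by (simp add: power2_sum)
  finally show ?thesis .
qed

lemma L2_add: "f \<in> L2 M \<Longrightarrow> g \<in> L2 M \<Longrightarrow> (\<lambda>x. f x + g x) \<in> L2 M"
  by (rule L2_bound[of _ _ "\<lambda>x. 2 * (cmod (f x))\<^sup>2 + 2 * (cmod (g x))\<^sup>2"])
    (auto simp: L2_integrable cmod_add_sq_le L2_measurable)

lemma L2_diff: "f \<in> L2 M \<Longrightarrow> g \<in> L2 M \<Longrightarrow> (\<lambda>x. f x - g x) \<in> L2 M"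
  using L2_add[OF _ L2_cmult[of g M "-1"]] by simp

lemma L2_zero: "(\<lambda>x. 0) \<in> L2 M"
  by (simp add: L2_def)

lemma L2_sum: "finite F \<Longrightarrow> F \<subseteq> L2 M \<Longrightarrow> (\<lambda>x. \<Sum>f\<in>F. c f * f x) \<in> L2 M"
  by (induction F rule: finite_induct) (auto simp: L2_zero intro!: L2_add L2_cmult)

lemma L2_inner_integrable:
  assumes "f \<in> L2 M" "g \<in> L2 M"
  shows "integrable M (\<lambda>x. f x * cnj (g x))"
proof (rule Bochner_Integration.integrable_bound)
  show "integrable M (\<lambda>x. (cmod (f x))\<^sup>2 + (cmod (g x))\<^sup>2)"
    using assms by (simp add: L2_integrable)
  have "cmod (f x) * cmod (g x) \<le> (cmod (f x))\<^sup>2 + (cmod (g x))\<^sup>2" for x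
    using sum_squares_bound[of "cmod (f x)" "cmod (g x)"] zero_le_power2[of "cmod (f x)"]
      zero_le_power2[of "cmod (g x)"] by linarith
  then show "AE x in M. norm (f x * cnj (g x)) \<le> norm ((cmod (f x))\<^sup>2 + (cmod (g x))\<^sup>2)"
    by (simp add: norm_mult)
qed (use assms in measurable)

lemma L2_inner_add_left:
  "f \<in> L2 M \<Longrightarrow> g \<in> L2 M \<Longrightarrow> h \<in> L2 M \<Longrightarrow>
    L2_inner M (\<lambda>x. f x + g x) h = L2_inner M f h + L2_inner M g h"
  by (simp add: L2_inner_def distrib_right L2_inner_integrable)

lemma L2_inner_diff_left:
  "f \<in> L2 M \<Longrightarrow> g \<in> L2 M \<Longrightarrow> h \<in> L2 M \<Longrightarrow>
    L2_inner M (\<lambda>x. f x - g x) h = L2_inner M f h - L2_inner M g h"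
  by (simp add: L2_inner_def left_diff_distrib L2_inner_integrable)

lemma L2_inner_cmult_left: "L2_inner M (\<lambda>x. c * f x) h = c * L2_inner M f h"
  by (simp add: L2_inner_def mult.assoc)

lemma L2_inner_commute: "L2_inner M f g = cnj (L2_inner M g f)"
proof -
  have "(\<lambda>x. f x * cnj (g x)) = (\<lambda>x. cnj (g x * cnj (f x)))" by (simp add: mult.commute)
  then show ?thesis unfolding L2_inner_def by (simp only: Bochner_Integration.integral_cnj)
qed

lemma L2_inner_diff_right:
  "f \<in> L2 M \<Longrightarrow> g \<in> L2 M \<Longrightarrow> h \<in> L2 M \<Longrightarrow>
    L2_inner M h (\<lambda>x. f x - g x) = L2_inner M h f - L2_inner M h g"
  using L2_inner_diff_left[of f M g h] by (metis L2_inner_commute complex_cnj_diff)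

lemma L2_inner_cmult_right: "L2_inner M h (\<lambda>x. c * f x) = cnj c * L2_inner M h f"
  by (metis L2_inner_cmult_left L2_inner_commute complex_cnj_mult)

lemma L2_inner_cong_AE:
  assumes "AE x in M. f x = f' x" "AE x in M. g x = g' x"
    and "f \<in> L2 M" "f' \<in> L2 M" "g \<in> L2 M" "g' \<in> L2 M"
  shows "L2_inner M f g = L2_inner M f' g'"
  unfolding L2_inner_def
  by (rule integral_cong_AE) (use assms in \<open>auto intro!: borel_measurable_times
      simp: L2_measurable borel_measurable_cnj elim: AE_mp[rotated]\<close>)

lemma L2_norm_nonneg [simp]: "0 \<le> L2_norm M f"
  by (simp add: L2_norm_def)

text \<open>Cauchy-Schwarz bounds the squared norm of an image by a multiple of that norm. This
  cancels one factor, both for the projection \<open>Q\<close> and for the adjoint \<open>A\<close>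
  below.\<close>

lemma power2_le_mult_imp_le: "x\<^sup>2 \<le> a * x \<Longrightarrow> 0 \<le> x \<Longrightarrow> 0 \<le> a \<Longrightarrow> x \<le> a" for a x :: real
  by (cases "x = 0") (auto simp: power2_eq_square mult_le_cancel_right)

lemma L2_norm_sq: "(L2_norm M f)\<^sup>2 = (\<integral>x. (cmod (f x))\<^sup>2 \<partial>M)"
  by (simp add: L2_norm_def)

lemma L2_inner_self: "L2_inner M f f = complex_of_real ((L2_norm M f)\<^sup>2)"
  unfolding L2_norm_sq L2_inner_def
  by (simp add: complex_norm_square[symmetric] integral_complex_of_real[symmetric] del: integral_complex_of_real)

lemma L2_norm_cmult: "L2_norm M (\<lambda>x. c * f x) = cmod c * L2_norm M f"
  by (simp add: L2_norm_def norm_mult power_mult_distrib real_sqrt_mult)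

lemma L2_norm_eq_0_AE:
  assumes "f \<in> L2 M" "L2_norm M f = 0"
  shows "AE x in M. f x = 0"
proof -
  have "(\<integral>x. (cmod (f x))\<^sup>2 \<partial>M) = 0" using assms(2) L2_norm_sq[of M f] by simp
  then show ?thesis
    using L2_integrable[OF assms(1)] by (subst (asm) integral_nonneg_eq_0_iff_AE) auto
qed

lemma L2_norm_minus_commute: "L2_norm M (\<lambda>x. f x - g x) = L2_norm M (\<lambda>x. g x - f x)"
  by (simp add: L2_norm_def norm_minus_commute)

text \<open>The scalar is kept general for three uses: \<open>c = -1\<close> gives the triangle
  inequality, \<open>c = 1\<close> and \<open>c = -1\<close> together the parallelogram law, and
  real multiples of the inner product give Cauchy-Schwarz and the orthogonality of a nearest
  point.\<close>

lemma L2_norm_diff_sq: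
  assumes "f \<in> L2 M" "g \<in> L2 M"
  shows "(L2_norm M (\<lambda>x. f x - c * g x))\<^sup>2 =
    (L2_norm M f)\<^sup>2 - 2 * Re (cnj c * L2_inner M f g) + (cmod c)\<^sup>2 * (L2_norm M g)\<^sup>2"
proof -
  note [simp] = L2_diff L2_cmult assms
  have "complex_of_real ((L2_norm M (\<lambda>x. f x - c * g x))\<^sup>2) =
      complex_of_real ((L2_norm M f)\<^sup>2) - (cnj c * L2_inner M f g + c * cnj (L2_inner M f g))
        + c * cnj c * complex_of_real ((L2_norm M g)\<^sup>2)"
    using L2_inner_commute[of M g f]
    unfolding L2_inner_self[symmetric]
    by (simp add: L2_inner_diff_left L2_inner_diff_right L2_inner_cmult_left L2_inner_cmult_right algebra_simps)
  also have "c * cnj (L2_inner M f g) = cnj (cnj c * L2_inner M f g)" by simp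
  also have "cnj c * L2_inner M f g + cnj (cnj c * L2_inner M f g) = complex_of_real (2 * Re (cnj c * L2_inner M f g))"
    by (rule complex_add_cnj)
  also have "c * cnj c = complex_of_real ((cmod c)\<^sup>2)"
    by (rule complex_norm_square[symmetric])
  finally show ?thesis
    unfolding of_real_mult[symmetric] of_real_diff[symmetric] of_real_add[symmetric] of_real_eq_iff .
qed

text \<open>For positive \<open>G\<close> the value at \<open>t = 1 / G\<close>, the vertex of the
  parabola, gives the claim. With \<open>A\<close> a squared inner product this is Cauchy-Schwarz;
  with \<open>F = 0\<close> it says that a minimiser is orthogonal.\<close>

lemma quadratic_nonneg_imp_le:
  fixes F A G :: real
  assumes "\<And>t. 0 \<le> F - 2 * t * A + t\<^sup>2 * (A * G)" "0 \<le> A" "0 \<le> G"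
  shows "A \<le> F * G"
proof (cases "G = 0")
  case True
  have "A = 0"
  proof (rule ccontr)
    assume "A \<noteq> 0"
    \<comment> \<open>With \<open>G = 0\<close> the polynomial is linear, and at this
      \<open>t\<close> its value is \<open>-1\<close>.\<close>
    with assms(1)[of "(F + 1) / (2 * A)"] True show False by simp
  qed
  with True show ?thesis by simp
next
  case False
  have "0 \<le> G * (F - 2 * (1 / G) * A + (1 / G)\<^sup>2 * (A * G))"
    using assms by (intro mult_nonneg_nonneg)
  also have "\<dots> = F * G - A" using False by (simp add: field_simps power2_eq_square)
  finally show ?thesis by simp
qed

text \<open>Scaling \<open>g\<close> by the inner product itself makes the cross term real, so a
  real parameter suffices over complex scalars.\<close>

lemma L2_inner_real_multiple:
  assumes "f \<in> L2 M" "g \<in> L2 M"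
  shows "(L2_norm M (\<lambda>x. f x - complex_of_real t * L2_inner M f g * g x))\<^sup>2 =
    (L2_norm M f)\<^sup>2 - 2 * t * (cmod (L2_inner M f g))\<^sup>2
      + t\<^sup>2 * ((cmod (L2_inner M f g))\<^sup>2 * (L2_norm M g)\<^sup>2)"
proof -
  define a where "a = L2_inner M f g"
  have "cnj (complex_of_real t * a) * a = complex_of_real (t * (cmod a)\<^sup>2)"
    using complex_norm_square[of a] by (simp add: mult.commute mult.left_commute)
  then have Re: "Re (cnj (complex_of_real t * a) * a) = t * (cmod a)\<^sup>2"
    by (simp only: Re_complex_of_real)
  show ?thesis
    using L2_norm_diff_sq[OF assms, of "complex_of_real t * a"]
    unfolding a_def[symmetric] Re by (simp add: norm_mult power_mult_distrib mult.assoc)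
qed

lemma L2_Cauchy_Schwarz:
  assumes "f \<in> L2 M" "g \<in> L2 M"
  shows "cmod (L2_inner M f g) \<le> L2_norm M f * L2_norm M g"
proof -
  have "(cmod (L2_inner M f g))\<^sup>2 \<le> (L2_norm M f)\<^sup>2 * (L2_norm M g)\<^sup>2"
    unfolding L2_inner_real_multiple[OF assms, symmetric]
    by (rule quadratic_nonneg_imp_le) (simp_all flip: L2_inner_real_multiple[OF assms])
  then show ?thesis
    by (simp add: power_mult_distrib[symmetric] power2_le_iff_abs_le)
qed

lemma L2_norm_triangle:
  assumes "f \<in> L2 M" "g \<in> L2 M"
  shows "L2_norm M (\<lambda>x. f x + g x) \<le> L2_norm M f + L2_norm M g"
proof -
  have "- Re (L2_inner M f g) \<le> cmod (L2_inner M f g)" "Re (L2_inner M f g) \<le> cmod (L2_inner M f g)"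
    using abs_Re_le_cmod[of "L2_inner M f g"] by linarith+
  then have "(L2_norm M (\<lambda>x. f x + g x))\<^sup>2 \<le> (L2_norm M f + L2_norm M g)\<^sup>2"
    using L2_norm_diff_sq[OF assms, of "-1"] L2_Cauchy_Schwarz[OF assms]
    by (simp add: power2_sum)
  then show ?thesis by (rule power2_le_imp_le) simp
qed

lemma L2_norm_triangle_diff:
  assumes "f \<in> L2 M" "g \<in> L2 M" "h \<in> L2 M"
  shows "L2_norm M (\<lambda>x. f x - h x) \<le> L2_norm M (\<lambda>x. f x - g x) + L2_norm M (\<lambda>x. g x - h x)"
  using L2_norm_triangle[OF L2_diff[OF assms(1,2)] L2_diff[OF assms(2,3)]] by simp

section \<open>Completeness and orthogonal projection\<close>

lemma L2_nn_integral:
  "f \<in> L2 M \<Longrightarrow> (\<integral>\<^sup>+x. ennreal ((cmod (f x))\<^sup>2) \<partial>M) = ennreal ((L2_norm M f)\<^sup>2)"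
  by (simp add: L2_norm_sq nn_integral_eq_integral L2_integrable)

lemma L2_nn_integralI:
  assumes f: "f \<in> borel_measurable M" and le: "(\<integral>\<^sup>+x. ennreal ((cmod (f x))\<^sup>2) \<partial>M) \<le> ennreal (c\<^sup>2)" and c: "0 \<le> c"
  shows "f \<in> L2 M" "L2_norm M f \<le> c"
proof -
  have "(\<integral>\<^sup>+x. ennreal (norm ((cmod (f x))\<^sup>2)) \<partial>M) < \<infinity>"
    using le by (simp add: order.strict_trans1)
  then show fL: "f \<in> L2 M"
    using f unfolding L2_def by (auto intro!: integrableI_bounded)
  show "L2_norm M f \<le> c"
    using le c power2_le_imp_le[of "L2_norm M f" c] unfolding L2_nn_integral[OF fL] by simp
qed

text \<open>The Riesz-Fischer argument for sequences with geometrically small steps, which a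
  suitable minimising sequence has. The bound on the distance to the limit is the tail of the
  geometric series.\<close>

lemma L2_complete:
  assumes h: "\<And>n. h n \<in> L2 M"
    and d: "\<And>n. L2_norm M (\<lambda>x. h n x - h (Suc n) x) \<le> (1/2) ^ n"
  shows "\<exists>l\<in>L2 M. \<forall>n. L2_norm M (\<lambda>x. h n x - l x) \<le> 2 * (1/2) ^ n"
proof -
  note [measurable] = L2_measurable[OF h]
  have dist: "L2_norm M (\<lambda>x. h n x - h (n + k) x) \<le> 2 * (1/2) ^ n - 2 * (1/2) ^ (n + k)" for n k
  proof (induction k)
    case 0
    then show ?case by (simp add: L2_norm_def)
  next
    case (Suc k)
    have "L2_norm M (\<lambda>x. h n x - h (n + Suc k) x) \<le>
        L2_norm M (\<lambda>x. h n x - h (n + k) x) + L2_norm M (\<lambda>x. h (n + k) x - h (n + Suc k) x)"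
      by (intro L2_norm_triangle_diff h)
    also have "\<dots> \<le> (2 * (1/2) ^ n - 2 * (1/2) ^ (n + k)) + (1/2) ^ (n + k)"
      using Suc d[of "n + k"] by simp
    finally show ?case by simp
  qed
  \<comment> \<open>The norms of these sums stay below 2, so their supremum is finite almost
    everywhere; there the telescoping series of \<open>h\<close> converges absolutely.\<close>
  define S where "S N x = (\<Sum>n<N. cmod (h n x - h (Suc n) x))" for N x
  have [measurable]: "S N \<in> borel_measurable M" for N
    unfolding S_def by measurable
  have S: "(\<lambda>x. complex_of_real (S N x)) \<in> L2 M \<and>
      L2_norm M (\<lambda>x. complex_of_real (S N x)) \<le> 2 - 2 * (1/2) ^ N" for N
  proof (induction N)
    case 0
    then show ?case by (simp add: S_def L2_zero L2_norm_def)
  next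
    case (Suc N)
    let ?d = "\<lambda>x. complex_of_real (cmod (h N x - h (Suc N) x))"
    have dL: "?d \<in> L2 M"
      using L2_diff[OF h h, of N "Suc N"] by (simp add: L2_def)
    have eq: "(\<lambda>x. complex_of_real (S (Suc N) x)) = (\<lambda>x. complex_of_real (S N x) + ?d x)"
      by (simp add: S_def)
    have "L2_norm M ?d \<le> (1/2) ^ N"
      using d[of N] by (simp add: L2_norm_def)
    then show ?case
      unfolding eq using Suc L2_norm_triangle[OF conjunct1[OF Suc] dL] L2_add[OF conjunct1[OF Suc] dL]
      by simp
  qed
  have mono: "S m x \<le> S n x" if "m \<le> n" for m n x
    using that unfolding S_def by (intro sum_mono2) auto
  have S0: "0 \<le> S N x" for N x by (simp add: S_def sum_nonneg)
  have "(\<integral>\<^sup>+x. (SUP N. ennreal ((S N x)\<^sup>2)) \<partial>M) = (SUP N. \<integral>\<^sup>+x. ennreal ((S N x)\<^sup>2) \<partial>M)"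
    using mono S0 by (intro nn_integral_monotone_convergence_SUP)
      (auto simp: incseq_def le_fun_def intro!: ennreal_leI power_mono)
  also have "\<dots> \<le> ennreal (2\<^sup>2)"
  proof (rule SUP_least)
    fix N
    have "L2_norm M (\<lambda>x. complex_of_real (S N x)) \<le> 2"
      using S[of N] zero_le_power[of "1/2::real" N] by linarith
    then have "(L2_norm M (\<lambda>x. complex_of_real (S N x)))\<^sup>2 \<le> 2\<^sup>2"
      by (intro power_mono) auto
    then show "(\<integral>\<^sup>+x. ennreal ((S N x)\<^sup>2) \<partial>M) \<le> ennreal (2\<^sup>2)"
      using L2_nn_integral[OF conjunct1[OF S[of N]]] by (simp add: ennreal_leI del: ennreal_numeral)
  qed
  finally have "(\<integral>\<^sup>+x. (SUP N. ennreal ((S N x)\<^sup>2)) \<partial>M) \<noteq> \<infinity>"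
    by (auto simp: top_unique)
  then have "AE x in M. (SUP N. ennreal ((S N x)\<^sup>2)) \<noteq> \<infinity>"
    by (intro nn_integral_PInf_AE) measurable
  then have conv: "AE x in M. convergent (\<lambda>n. h n x)"
  proof eventually_elim
    case (elim x)
    then obtain B where B: "(SUP N. ennreal ((S N x)\<^sup>2)) = ennreal B" "0 \<le> B"
      by (metis ennreal_cases infinity_ennreal_def)
    have "S N x \<le> sqrt B" for N
    proof -
      have "ennreal ((S N x)\<^sup>2) \<le> ennreal B"
        unfolding B(1)[symmetric] by (rule SUP_upper) simp
      then show ?thesis using B(2) by (simp add: real_le_rsqrt)
    qed
    then have "summable (\<lambda>n. cmod (h n x - h (Suc n) x))"
      by (intro summableI_nonneg_bounded[of _ "sqrt B"]) (auto simp: S_def)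
    then have "summable (\<lambda>n. h n x - h (Suc n) x)"
      by (rule summable_norm_cancel)
    then have "convergent (\<lambda>N. \<Sum>n<N. h n x - h (Suc n) x)"
      by (simp add: summable_iff_convergent)
    then have "convergent (\<lambda>N. h 0 x - (\<Sum>n<N. h n x - h (Suc n) x))"
      by (intro convergent_diff convergent_const)
    moreover have "(\<lambda>N. h 0 x - (\<Sum>n<N. h n x - h (Suc n) x)) = (\<lambda>N. h N x)"
      using sum_lessThan_telescope'[of "\<lambda>n. h n x"] by (intro ext) simp
    ultimately show ?case by simp
  qed
  define l where "l x = lim (\<lambda>n. h n x)" for x
  have [measurable]: "l \<in> borel_measurable M"
    unfolding l_def by measurable
  have le: "(\<lambda>x. h n x - l x) \<in> L2 M \<and> L2_norm M (\<lambda>x. h n x - l x) \<le> 2 * (1/2) ^ n" for n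
  proof -
    have "AE x in M. ennreal ((cmod (h n x - l x))\<^sup>2) = liminf (\<lambda>m. ennreal ((cmod (h n x - h m x))\<^sup>2))"
      using conv
    proof eventually_elim
      case (elim x)
      then have "(\<lambda>m. h m x) \<longlonglongrightarrow> l x"
        by (simp add: l_def convergent_LIMSEQ_iff)
      then have "(\<lambda>m. ennreal ((cmod (h n x - h m x))\<^sup>2)) \<longlonglongrightarrow> ennreal ((cmod (h n x - l x))\<^sup>2)"
        by (intro tendsto_intros tendsto_ennrealI)
      from lim_imp_Liminf[OF _ this] show ?case by simp
    qed
    then have "(\<integral>\<^sup>+x. ennreal ((cmod (h n x - l x))\<^sup>2) \<partial>M) =
        (\<integral>\<^sup>+x. liminf (\<lambda>m. ennreal ((cmod (h n x - h m x))\<^sup>2)) \<partial>M)"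
      by (rule nn_integral_cong_AE)
    \<comment> \<open>Fatou's lemma carries the bounds on the mutual distances over to the
      limit.\<close>
    also have "\<dots> \<le> liminf (\<lambda>m. \<integral>\<^sup>+x. ennreal ((cmod (h n x - h m x))\<^sup>2) \<partial>M)"
      by (rule nn_integral_liminf) measurable
    also have "\<dots> \<le> limsup (\<lambda>m. \<integral>\<^sup>+x. ennreal ((cmod (h n x - h m x))\<^sup>2) \<partial>M)"
      by (intro Liminf_le_Limsup) simp
    also have "\<dots> \<le> ennreal ((2 * (1/2) ^ n)\<^sup>2)"
    proof (rule Limsup_bounded)
      have "(\<integral>\<^sup>+x. ennreal ((cmod (h n x - h m x))\<^sup>2) \<partial>M) \<le> ennreal ((2 * (1/2) ^ n)\<^sup>2)" if "n \<le> m" for m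
      proof -
        have "L2_norm M (\<lambda>x. h n x - h m x) \<le> 2 * (1/2) ^ n"
          using dist[of n "m - n"] that zero_le_power[of "1/2::real" m] by (simp del: zero_le_power)
        then show ?thesis
          unfolding L2_nn_integral[OF L2_diff[OF h h]] by (intro ennreal_leI power_mono) auto
      qed
      then show "\<forall>\<^sub>F m in sequentially. (\<integral>\<^sup>+x. ennreal ((cmod (h n x - h m x))\<^sup>2) \<partial>M) \<le> ennreal ((2 * (1/2) ^ n)\<^sup>2)"
        unfolding eventually_sequentially by blast
    qed
    finally show ?thesis
      using L2_nn_integralI[of "\<lambda>x. h n x - l x" M "2 * (1/2) ^ n"] by simp
  qed
  have "l \<in> L2 M"
    using L2_diff[OF h[of 0] conjunct1[OF le[of 0]]] by simp
  with le show ?thesis by blast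
qed

text \<open>A minimising sequence for the distance from \<open>f\<close> to \<open>N\<close> is
  Cauchy by the parallelogram law. Closedness is expressed by distances, so \<open>N\<close> is also
  saturated under equality almost everywhere.\<close>

lemma L2_projection:
  assumes N: "N \<subseteq> L2 M" "N \<noteq> {}"
    and lin: "\<And>h k c. h \<in> N \<Longrightarrow> k \<in> N \<Longrightarrow> (\<lambda>x. h x + c * k x) \<in> N"
    and closed: "\<And>f. f \<in> L2 M \<Longrightarrow> (\<And>e. e > 0 \<Longrightarrow> \<exists>h\<in>N. L2_norm M (\<lambda>x. f x - h x) < e) \<Longrightarrow> f \<in> N"
    and f: "f \<in> L2 M"
  shows "\<exists>h\<in>N. \<forall>k\<in>N. L2_inner M (\<lambda>x. f x - h x) k = 0"
proof -
  define D where "D h = (L2_norm M (\<lambda>x. f x - h x))\<^sup>2" for h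
  define d where "d = (INF h\<in>N. D h)"
  have bdd: "bdd_below (D ` N)" by (auto simp: D_def intro!: bdd_belowI[of _ 0])
  have d_le: "d \<le> D h" if "h \<in> N" for h
    unfolding d_def using bdd that by (rule cINF_lower)
  \<comment> \<open>The parallelogram law bounds the squared step by
    \<open>2 * D (h n) + 2 * D (h (Suc n)) - 4 * d\<close>. An excess of
    \<open>(1/4) ^ n / 4\<close> keeps this below \<open>(1/4) ^ n\<close>, the square of what
    \<open>L2_complete\<close> asks for.\<close>
  have "\<exists>h\<in>N. D h < d + (1/4) ^ n / 4" for n :: nat
    using cInf_lessD[of "D ` N" "d + (1/4) ^ n / 4"] N(2) by (auto simp: d_def)
  then have "\<forall>n::nat. \<exists>h. h \<in> N \<and> D h < d + (1/4) ^ n / 4" by blast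
  from choice[OF this] obtain h
    where h: "\<forall>n::nat. h n \<in> N \<and> D (h n) < d + (1/4) ^ n / 4" ..
  then have hL: "h n \<in> L2 M" for n using N by blast
  have near: "L2_norm M (\<lambda>x. h n x - h (Suc n) x) \<le> (1/2) ^ n" for n
  proof -
    let ?a = "\<lambda>x. f x - h n x" and ?b = "\<lambda>x. f x - h (Suc n) x"
    have ab: "?a \<in> L2 M" "?b \<in> L2 M" using f hL by (auto intro: L2_diff)
    \<comment> \<open>This is the midpoint of \<open>h n\<close> and \<open>h (Suc n)\<close>, in
      the form that two uses of \<open>lin\<close> produce.\<close>
    have m0: "(\<lambda>x. h n x + (-1/2) * (h n x + (-1) * h (Suc n) x)) \<in> N"
      using h by (intro lin) auto
    have half: "(\<lambda>x. f x - (h n x + (-1/2) * (h n x + (-1) * h (Suc n) x))) = (\<lambda>x. (1/2) * (?a x - (-1) * ?b x))"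
      by (auto simp: field_simps)
    have "D (\<lambda>x. h n x + (-1/2) * (h n x + (-1) * h (Suc n) x)) = (L2_norm M (\<lambda>x. ?a x - (-1) * ?b x))\<^sup>2 / 4"
      unfolding D_def half L2_norm_cmult by (simp add: power_mult_distrib power2_eq_square)
    with d_le[OF m0] have "4 * d \<le> (L2_norm M (\<lambda>x. ?a x - (-1) * ?b x))\<^sup>2" by simp
    moreover have "(L2_norm M (\<lambda>x. ?a x - (-1) * ?b x))\<^sup>2 + (L2_norm M (\<lambda>x. ?a x - 1 * ?b x))\<^sup>2
        = 2 * D (h n) + 2 * D (h (Suc n))"
      unfolding L2_norm_diff_sq[OF ab] D_def by simp
    moreover have "(\<lambda>x. ?a x - 1 * ?b x) = (\<lambda>x. h (Suc n) x - h n x)" by auto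
    ultimately have "(L2_norm M (\<lambda>x. h (Suc n) x - h n x))\<^sup>2 \<le> 2 * D (h n) + 2 * D (h (Suc n)) - 4 * d"
      by simp
    also have "\<dots> \<le> (1/4) ^ n"
      using h[rule_format, of n] h[rule_format, of "Suc n"] zero_le_power[of "1/4::real" n]
      by (simp del: zero_le_power)
    also have "\<dots> = ((1/2) ^ n)\<^sup>2"
      by (simp add: power2_eq_square power_mult_distrib[symmetric])
    finally show ?thesis
      unfolding L2_norm_minus_commute[of M "h n"] by (rule power2_le_imp_le) simp
  qed
  obtain l where l: "l \<in> L2 M" "\<And>n. L2_norm M (\<lambda>x. h n x - l x) \<le> 2 * (1/2) ^ n"
    using L2_complete[OF hL near] by blast
  have small: "(\<lambda>n. 2 * (1/2::real) ^ n) \<longlonglongrightarrow> 0"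
    by (intro tendsto_mult_right_zero LIMSEQ_realpow_zero) auto
  have lN: "l \<in> N"
  proof (rule closed[OF l(1)])
    fix e :: real assume "e > 0"
    then obtain n where "2 * (1/2::real) ^ n < e"
      using order_tendstoD(2)[OF small] by (auto simp: eventually_sequentially)
    with l(2)[of n] h show "\<exists>h\<in>N. L2_norm M (\<lambda>x. l x - h x) < e"
      by (intro bexI[of _ "h n"]) (auto simp: L2_norm_minus_commute[of M l])
  qed
  have "D l \<le> d"
  proof -
    have le: "L2_norm M (\<lambda>x. f x - l x) \<le> sqrt (d + (1/4) ^ n / 4) + 2 * (1/2) ^ n" for n
    proof -
      have "L2_norm M (\<lambda>x. f x - h n x) \<le> sqrt (d + (1/4) ^ n / 4)"
        using h[rule_format, of n] by (intro real_le_rsqrt) (simp add: D_def)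
      with L2_norm_triangle_diff[OF f hL l(1), of n] l(2)[of n] show ?thesis by linarith
    qed
    have "(\<lambda>n. sqrt (d + (1/4) ^ n / 4) + 2 * (1/2) ^ n) \<longlonglongrightarrow> sqrt (d + 0 / 4) + 0"
      by (intro tendsto_intros small LIMSEQ_realpow_zero) auto
    then have "L2_norm M (\<lambda>x. f x - l x) \<le> sqrt d"
      using le by (intro LIMSEQ_le_const[of _ "sqrt d"]) auto
    moreover have "0 \<le> d" unfolding d_def using N(2) by (intro cINF_greatest) (auto simp: D_def)
    ultimately show ?thesis unfolding D_def
      by (metis L2_norm_nonneg power_mono real_sqrt_pow2)
  qed
  have "L2_inner M (\<lambda>x. f x - l x) k = 0" if k: "k \<in> N" for k
  proof -
    let ?g = "\<lambda>x. f x - l x"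
    have gk: "?g \<in> L2 M" "k \<in> L2 M" using f l k N by (auto intro: L2_diff)
    \<comment> \<open>Moving from the minimiser \<open>l\<close> along \<open>k\<close> cannot bring
      it closer to \<open>f\<close>; the constant term is 0 because \<open>D l\<close> cancels
      against \<open>d\<close>.\<close>
    have "0 \<le> 0 - 2 * t * (cmod (L2_inner M ?g k))\<^sup>2
      + t\<^sup>2 * ((cmod (L2_inner M ?g k))\<^sup>2 * (L2_norm M k)\<^sup>2)" for t
    proof -
      have "d \<le> D (\<lambda>x. l x + (complex_of_real t * L2_inner M ?g k) * k x)"
        by (intro d_le lin lN k)
      also have "\<dots> = (L2_norm M (\<lambda>x. ?g x - complex_of_real t * L2_inner M ?g k * k x))\<^sup>2"
        by (simp add: D_def diff_diff_eq)
      finally show ?thesis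
        unfolding L2_inner_real_multiple[OF gk] using \<open>D l \<le> d\<close> by (simp add: D_def)
    qed
    then have "(cmod (L2_inner M ?g k))\<^sup>2 \<le> 0 * (L2_norm M k)\<^sup>2"
      by (rule quadratic_nonneg_imp_le) auto
    then show ?thesis by simp
  qed
  with lN show ?thesis by blast
qed

lemma L2_orthogonal_closed_span:
  assumes A: "A \<subseteq> L2 M" and g: "g \<in> L2 M" and 0: "\<And>f. f \<in> A \<Longrightarrow> L2_inner M f g = 0"
    and f: "f \<in> L2_closed_span M A"
  shows "L2_inner M f g = 0"
proof -
  have span: "L2_inner M (\<lambda>x. \<Sum>f\<in>F. c f * f x) g = 0" if F: "finite F" "F \<subseteq> A" for F c
    using F
  proof (induction F rule: finite_induct)
    case empty
    then show ?case by (simp add: L2_inner_def)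
  next
    case (insert a F)
    then have "a \<in> L2 M" "(\<lambda>x. \<Sum>f\<in>F. c f * f x) \<in> L2 M" using A by (auto intro!: L2_sum)
    then show ?case using insert g 0 by (simp add: L2_inner_add_left L2_inner_cmult_left L2_cmult)
  qed
  have fL: "f \<in> L2 M" using f by (auto simp: L2_closed_span_def L2_closure_def)
  have "cmod (L2_inner M f g) \<le> 0"
  proof (rule field_le_epsilon)
    fix e :: real assume e: "e > 0"
    define p where "p = L2_norm M g + 1"
    have p: "p > 0" by (simp add: p_def add_nonneg_pos)
    have "e / p > 0" using e p by simp
    then obtain F c where F: "finite F" "F \<subseteq> A"
      and lt: "L2_norm M (\<lambda>x. f x - (\<Sum>f\<in>F. c f * f x)) < e / p"
      using f unfolding L2_closed_span_def L2_closure_def by blast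
    have sL: "(\<lambda>x. \<Sum>f\<in>F. c f * f x) \<in> L2 M" using F A by (intro L2_sum) auto
    have "L2_inner M f g = L2_inner M (\<lambda>x. f x - (\<Sum>f\<in>F. c f * f x)) g"
      using span[OF F] by (simp add: L2_inner_diff_left fL sL g)
    then have "cmod (L2_inner M f g) \<le> L2_norm M (\<lambda>x. f x - (\<Sum>f\<in>F. c f * f x)) * L2_norm M g"
      using L2_Cauchy_Schwarz[OF L2_diff[OF fL sL] g] by simp
    also have "\<dots> \<le> (e / p) * p"
      using lt e p by (intro mult_mono) (auto simp: p_def)
    finally show "cmod (L2_inner M f g) \<le> 0 + e" using p by simp
  qed
  then show ?thesis by simp
qed

lemma L2_bounded_operator_add:
  "L2_bounded_operator M T \<Longrightarrow> f \<in> L2 M \<Longrightarrow> g \<in> L2 M \<Longrightarrow>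
    AE x in M. T (\<lambda>y. f y + g y) x = T f x + T g x"
  by (simp add: L2_bounded_operator_def)

text \<open>Operators act on functions rather than on classes. The difference of \<open>f\<close>
  and \<open>g\<close> has norm 0, so boundedness makes its image vanish almost everywhere.\<close>

lemma L2_bounded_operator_cong:
  assumes T: "L2_bounded_operator M T" and fg: "f \<in> L2 M" "g \<in> L2 M" and eq: "AE x in M. f x = g x"
  shows "AE x in M. T f x = T g x"
proof -
  let ?d = "\<lambda>x. f x - g x"
  obtain C where C: "\<forall>f\<in>L2 M. L2_norm M (T f) \<le> C * L2_norm M f"
    using T unfolding L2_bounded_operator_def by blast
  have d: "?d \<in> L2 M" by (intro L2_diff fg)
  have "L2_norm M ?d = 0"
    unfolding L2_norm_def using eq by (simp add: integral_eq_zero_AE)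
  with C d have "L2_norm M (T ?d) = 0" by (metis L2_norm_nonneg antisym mult_zero_right)
  moreover have "T ?d \<in> L2 M" using T d unfolding L2_bounded_operator_def by blast
  ultimately have "AE x in M. T ?d x = 0" by (intro L2_norm_eq_0_AE)
  moreover have "AE x in M. T (\<lambda>y. g y + ?d y) x = T g x + T ?d x"
    using L2_bounded_operator_add[OF T fg(2) d] .
  ultimately show ?thesis by eventually_elim simp
qed

lemma L2_closure_superset: "f \<in> S \<Longrightarrow> f \<in> L2 M \<Longrightarrow> f \<in> L2_closure M S"
  unfolding L2_closure_def by (auto simp: L2_norm_def intro!: bexI[of _ f])

section \<open>Translations and the left group algebra\<close>

lemma left_regular_left_regular: "left_regular s (left_regular t f) = left_regular (s + t) f"
  by (simp only: left_regular_def minus_add add.assoc)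

lemma left_regular_0 [simp]: "left_regular 0 f = f"
  by (simp add: left_regular_def)

context haar_group begin

lemma left_regular_L2:
  assumes "f \<in> L2 M" shows "left_regular s f \<in> L2 M"
  using assms integrable_left[of "\<lambda>x. (cmod (f x))\<^sup>2" "- s"]
    measurable_compose[OF measurable_translation(1)[of "- s"], of f borel]
  by (simp add: L2_def left_regular_def)

lemma L2_inner_left_regular:
  assumes "f \<in> L2 M" "g \<in> L2 M"
  shows "L2_inner M (left_regular s f) (left_regular s g) = L2_inner M f g"
  using integral_left[of "\<lambda>x. f x * cnj (g x)" "- s"] L2_inner_integrable[OF assms]
  by (simp add: L2_inner_def left_regular_def)

lemma L2_inner_left_regular_shift:
  assumes "f \<in> L2 M" "g \<in> L2 M"
  shows "L2_inner M (left_regular s f) g = L2_inner M f (left_regular (- s) g)"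
  using L2_inner_left_regular[OF assms(1) left_regular_L2[OF assms(2)], of s "- s"]
  by (simp add: left_regular_left_regular)

lemma id_left_group_algebra: "(\<lambda>f. f) \<in> left_group_algebra M"
  unfolding left_group_algebra_def L2_commutant_def[of M "L2_commutant M _"] L2_bounded_operator_def
  by (auto intro!: exI[of _ 1])

lemma left_group_algebra_L2: "T \<in> left_group_algebra M \<Longrightarrow> f \<in> L2 M \<Longrightarrow> T f \<in> L2 M"
  by (simp add: left_group_algebra_def L2_commutant_def L2_bounded_operator_def)

text \<open>The orthogonal projection \<open>Q\<close> onto the orthogonal complement of the orbit of \<open>g\<close>
  commutes with translations, hence with the left group algebra, and \<open>Q f = f\<close>, \<open>Q g = 0\<close>.\<close>

lemma left_group_algebra_orthogonal:
  assumes f: "f \<in> L2 M" and g: "g \<in> L2 M"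
    and orth: "\<And>s. L2_inner M f (left_regular s g) = 0"
    and T: "T \<in> left_group_algebra M" and S: "S \<in> left_group_algebra M"
  shows "L2_inner M (T f) (S g) = 0"
proof -
  define N where "N = {h \<in> L2 M. \<forall>s. L2_inner M h (left_regular s g) = 0}"
  have NL: "h \<in> L2 M" if "h \<in> N" for h using that by (simp add: N_def)
  have gs: "left_regular s g \<in> L2 M" for s by (rule left_regular_L2[OF g])
  have lin: "(\<lambda>x. h x + c * k x) \<in> N" if "h \<in> N" "k \<in> N" for h k c
    using that gs by (auto simp: N_def L2_inner_add_left L2_inner_cmult_left L2_add L2_cmult)
  have lin_diff: "(\<lambda>x. h x - k x) \<in> N" if "h \<in> N" "k \<in> N" for h k
    using lin[OF that, of "-1"] by simp
  have closed: "h \<in> N" if h: "h \<in> L2 M" and near: "\<And>e. e > 0 \<Longrightarrow> \<exists>k\<in>N. L2_norm M (\<lambda>x. h x - k x) < e" for h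
  proof -
    \<comment> \<open>Each element of \<open>N\<close> is a combination with one term, so
      approximating \<open>h\<close> by \<open>N\<close> puts it into the closed span, and
      orthogonality to the orbit passes to \<open>h\<close>.\<close>
    have "h \<in> L2_closed_span M N"
      unfolding L2_closed_span_def L2_closure_def
    proof (intro CollectI conjI h allI impI)
      fix e :: real assume "e > 0"
      then obtain k where k: "k \<in> N" "L2_norm M (\<lambda>x. h x - k x) < e" using near by blast
      have "k \<in> {(\<lambda>x. \<Sum>f\<in>F. c f * f x) | F c. finite F \<and> F \<subseteq> N}"
        using k(1) by (intro CollectI exI[of _ "{k}"] exI[of _ "\<lambda>_. 1"]) auto
      with k NL[OF k(1)]
      show "\<exists>k\<in>{(\<lambda>x. \<Sum>f\<in>F. c f * f x) | F c. finite F \<and> F \<subseteq> N} \<inter> L2 M. L2_norm M (\<lambda>x. h x - k x) < e"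
        by (intro bexI[of _ k] IntI)
    qed
    then have "L2_inner M h (left_regular s g) = 0" for s
      by (rule L2_orthogonal_closed_span[rotated 3]) (auto simp: N_def gs)
    with h show ?thesis by (simp add: N_def)
  qed
  have zero: "(\<lambda>x. 0) \<in> N" by (simp add: N_def L2_zero) (simp add: L2_inner_def)
  then have proj: "\<exists>k. k \<in> N \<and> (\<forall>n\<in>N. L2_inner M (\<lambda>x. h x - k x) n = 0)" if "h \<in> L2 M" for h
    using L2_projection[of N M h] NL lin closed that by blast
  \<comment> \<open>A choice of representative is made for each projection. By \<open>uniq\<close>
    it is determined up to a null set, which is how linearity and commutation are obtained almost
    everywhere.\<close>
  define Q where "Q h = (SOME k. k \<in> N \<and> (\<forall>n\<in>N. L2_inner M (\<lambda>x. h x - k x) n = 0))" for h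
  have Q: "Q h \<in> N" "\<And>n. n \<in> N \<Longrightarrow> L2_inner M (\<lambda>x. h x - Q h x) n = 0" if "h \<in> L2 M" for h
    using someI_ex[OF proj[OF that]] by (auto simp: Q_def)
  note QL = NL[OF Q(1)]
  have uniq: "AE x in M. Q h x = k x"
    if h: "h \<in> L2 M" and k: "k \<in> N" and hk: "\<And>n. n \<in> N \<Longrightarrow> L2_inner M (\<lambda>x. h x - k x) n = 0" for h k
  proof -
    let ?d = "\<lambda>x. Q h x - k x"
    have d: "?d \<in> N" by (intro lin_diff Q h k)
    have "L2_inner M ?d ?d = L2_inner M (\<lambda>x. (h x - k x) - (h x - Q h x)) ?d" by simp
    also have "\<dots> = L2_inner M (\<lambda>x. h x - k x) ?d - L2_inner M (\<lambda>x. h x - Q h x) ?d"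
      using h k d by (intro L2_inner_diff_left) (auto intro: L2_diff NL QL)
    also have "\<dots> = 0" using hk[OF d] Q(2)[OF h d] by simp
    finally have "L2_norm M ?d = 0" by (simp add: L2_inner_self)
    with NL[OF d] have "AE x in M. ?d x = 0" by (intro L2_norm_eq_0_AE)
    then show ?thesis by eventually_elim simp
  qed
  have bounded: "L2_bounded_operator M Q"
    unfolding L2_bounded_operator_def
  proof (intro conjI ballI allI)
    fix h assume "h \<in> L2 M" then show "Q h \<in> L2 M" by (rule QL)
  next
    fix h k assume h: "h \<in> L2 M" and k: "k \<in> L2 M"
    show "AE x in M. Q (\<lambda>y. h y + k y) x = Q h x + Q k x"
    proof (rule uniq)
      show "(\<lambda>x. Q h x + Q k x) \<in> N" using lin[OF Q(1)[OF h] Q(1)[OF k], of 1] by simp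
      fix n assume n: "n \<in> N"
      have "L2_inner M (\<lambda>x. (h x - Q h x) + (k x - Q k x)) n = 0"
        using h k n Q(2) by (subst L2_inner_add_left) (auto intro: L2_diff QL NL)
      then show "L2_inner M (\<lambda>x. h x + k x - (Q h x + Q k x)) n = 0"
        by (simp add: algebra_simps)
    qed (intro L2_add h k)
  next
    fix c h assume h: "h \<in> L2 M"
    show "AE x in M. Q (\<lambda>y. c * h y) x = c * Q h x"
    proof (rule uniq)
      show "(\<lambda>x. c * Q h x) \<in> N" using lin[OF zero Q(1)[OF h], of c] by simp
      fix n assume n: "n \<in> N"
      have "L2_inner M (\<lambda>x. c * (h x - Q h x)) n = 0"
        using Q(2)[OF h n] by (simp only: L2_inner_cmult_left mult_zero_right)
      then show "L2_inner M (\<lambda>x. c * h x - c * Q h x) n = 0"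
        by (simp add: right_diff_distrib)
    qed (intro L2_cmult h)
  next
    have "L2_norm M (Q h) \<le> 1 * L2_norm M h" if h: "h \<in> L2 M" for h
    proof -
      have "L2_inner M h (Q h) = L2_inner M (\<lambda>x. h x - Q h x) (Q h) + L2_inner M (Q h) (Q h)"
        using L2_inner_add_left[OF L2_diff[OF h QL[OF h]] QL[OF h] QL[OF h]] by simp
      then have "complex_of_real ((L2_norm M (Q h))\<^sup>2) = L2_inner M h (Q h)"
        using Q(2)[OF h Q(1)[OF h]] by (simp add: L2_inner_self)
      then have "(L2_norm M (Q h))\<^sup>2 = cmod (L2_inner M h (Q h))"
        by (metis norm_of_real abs_of_nonneg zero_le_power2)
      also have "\<dots> \<le> L2_norm M h * L2_norm M (Q h)"
        by (rule L2_Cauchy_Schwarz[OF h QL[OF h]])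
      finally show ?thesis
        using power2_le_mult_imp_le[OF _ L2_norm_nonneg L2_norm_nonneg] by simp
    qed
    then show "\<exists>C. \<forall>h\<in>L2 M. L2_norm M (Q h) \<le> C * L2_norm M h" by blast
  qed
  have "Q \<in> L2_commutant M (range left_regular)"
    unfolding L2_commutant_def
  proof (intro CollectI conjI bounded ballI)
    fix U :: "('a \<Rightarrow> complex) \<Rightarrow> 'a \<Rightarrow> complex" and h
    assume "U \<in> range left_regular" and h: "h \<in> L2 M"
    then obtain s where U: "U = left_regular s" by blast
    \<comment> \<open>Translations are unitary and permute the orbit of \<open>g\<close>, so they
      preserve \<open>N\<close>.\<close>
    have shift: "left_regular s n \<in> N" if "n \<in> N" for s n
      using that left_regular_L2 gs
      by (auto simp: N_def L2_inner_left_regular_shift g left_regular_left_regular)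
    show "AE x in M. Q (U h) x = U (Q h) x"
      unfolding U
    proof (rule uniq)
      fix n assume n: "n \<in> N"
      have "L2_inner M (left_regular s (\<lambda>x. h x - Q h x)) n = 0"
        using L2_inner_left_regular_shift[OF L2_diff[OF h QL[OF h]] NL[OF n]] Q(2)[OF h shift[OF n]] by simp
      then show "L2_inner M (\<lambda>x. left_regular s h x - left_regular s (Q h) x) n = 0"
        by (simp add: left_regular_def)
    qed (intro left_regular_L2 h shift Q)+
  qed
  then have comm: "AE x in M. R (Q h) x = Q (R h) x" if "R \<in> left_group_algebra M" "h \<in> L2 M" for R h
    using that unfolding left_group_algebra_def L2_commutant_def[of M "L2_commutant M _"] by blast
  have bdd: "L2_bounded_operator M R" if "R \<in> left_group_algebra M" for R
    using that unfolding left_group_algebra_def L2_commutant_def[of M "L2_commutant M _"] by blast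
  have Qf: "AE x in M. Q f x = f x"
    using f orth by (intro uniq) (auto simp: N_def L2_inner_def)
  have Qg: "AE x in M. Q g x = 0"
  proof (rule uniq[OF g zero])
    fix n assume "n \<in> N"
    then have "L2_inner M n (left_regular 0 g) = 0" unfolding N_def by blast
    then show "L2_inner M (\<lambda>x. g x - 0) n = 0"
      using L2_inner_commute[of M g n] by simp
  qed
  let ?a = "T f" and ?b = "S g"
  have aL: "?a \<in> L2 M" and bL: "?b \<in> L2 M" using T S f g left_group_algebra_L2 by blast+
  have Qa: "AE x in M. ?a x = Q ?a x"
    using L2_bounded_operator_cong[OF bdd[OF T] QL[OF f] f Qf] comm[OF T f] by eventually_elim simp
  \<comment> \<open>\<open>S\<close> need not fix the zero function; its boundedness only gives an
    image of norm 0.\<close>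
  have S0: "AE x in M. S (\<lambda>x. 0) x = 0"
  proof -
    obtain C where "\<forall>h\<in>L2 M. L2_norm M (S h) \<le> C * L2_norm M h"
      using bdd[OF S] unfolding L2_bounded_operator_def by blast
    then have "L2_norm M (S (\<lambda>x. 0)) \<le> 0" using L2_zero by (force simp: L2_norm_def)
    then show ?thesis
      by (intro L2_norm_eq_0_AE left_group_algebra_L2[OF S L2_zero]) (simp add: antisym)
  qed
  have Qb: "AE x in M. Q ?b x = 0"
    using L2_bounded_operator_cong[OF bdd[OF S] QL[OF g] L2_zero Qg] comm[OF S g] S0
    by eventually_elim simp
  \<comment> \<open>\<open>Q ?b\<close> vanishes almost everywhere, so \<open>?b\<close> may be
    replaced by its component orthogonal to \<open>N\<close>, and \<open>Q ?a\<close> lies in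
    \<open>N\<close>.\<close>
  have "L2_inner M ?b (Q ?a) = L2_inner M (\<lambda>x. ?b x - Q ?b x) (Q ?a)"
    using Qb by (intro L2_inner_cong_AE L2_diff aL bL QL) auto
  also have "\<dots> = 0" by (rule Q(2)[OF bL Q(1)[OF aL]])
  finally have "L2_inner M (Q ?a) ?b = 0"
    using L2_inner_commute[of M "Q ?a" ?b] by simp
  then show ?thesis
    using L2_inner_cong_AE[OF Qa _ aL QL[OF aL] bL bL] by simp
qed

end

section \<open>Admissible vectors\<close>

lemma cinner_add_right: "cinner x (y + z) = cinner x y + cinner x z"
  by (metis cinner_add_left cinner_commute complex_cnj_add)

lemma cinner_zero_left [simp]: "cinner 0 y = 0"
  using cinner_add_left[of 0 0 y] by simp

text \<open>Polarisation reduces continuity of the inner product to continuity of the norm.\<close>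

lemma Re_cinner: "Re (cinner x y) = ((norm (x + y))\<^sup>2 - (norm x)\<^sup>2 - (norm y)\<^sup>2) / 2"
proof -
  have "cinner (x + y) (x + y) = cinner x x + cinner y y + (cinner x y + cnj (cinner x y))"
    using cinner_commute[of y x] by (simp add: cinner_add_left cinner_add_right)
  also have "cinner x y + cnj (cinner x y) = complex_of_real (2 * Re (cinner x y))"
    by (rule complex_add_cnj)
  finally show ?thesis
    unfolding cinner_self of_real_add[symmetric] of_real_eq_iff by simp
qed

lemma continuous_on_cinner:
  assumes "continuous_on A f"
  shows "continuous_on A (\<lambda>s. cinner x (f s))"
proof -
  have "cinner x (f s) = Complex (Re (cinner x (f s))) (- Re (cinner (\<i> *\<^sub>C x) (f s)))" for s
    by (simp add: cinner_scaleC_left complex_eq_iff)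
  then show ?thesis
    unfolding Re_cinner using assms by (auto intro!: continuous_intros simp: Complex_eq)
qed

text \<open>The exponent \<open>-1/2\<close> lies between 0 and \<open>-1\<close>, so the power is
  at most the larger of 1 and \<open>inverse d\<close>. Thus a function that is square integrable
  for the weights 1 and \<open>inverse \<delta>\<close> is in the domain of the modular power
  \<open>-1/4\<close>.\<close>

lemma powr_minus_quarter_sq_le: "d powr (-1/4) * d powr (-1/4) \<le> 1 + inverse d" if "0 < d" for d :: real
proof -
  have "d powr (-1/4) * d powr (-1/4) = d powr (-1/2)"
    by (simp add: powr_add[symmetric])
  also have "\<dots> \<le> max (d powr 0) (d powr (-1))"
  proof (cases "1 \<le> d")
    case True
    then have "d powr (-1/2) \<le> d powr 0" by (intro powr_mono) auto
    then show ?thesis by (rule max.coboundedI1)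
  next
    case False
    then have "d powr (-1/2) \<le> d powr (-1)" using that by (intro powr_mono') auto
    then show ?thesis by (rule max.coboundedI2)
  qed
  also have "\<dots> \<le> 1 + inverse d" using that by (simp add: powr_minus)
  finally show ?thesis .
qed

section \<open>The transform of an admissible vector and its adjoint\<close>

locale wavelet = haar_group M \<delta>
  for M :: "'a::locally_compact_group measure" and \<delta> :: "'a \<Rightarrow> real" +
  fixes \<pi> :: "'a \<Rightarrow> 'h::complex_hilbert_space \<Rightarrow> 'h" and \<eta> :: 'h
  assumes rep: "unitary_representation \<pi>" and admissible: "admissible M \<pi> \<eta>"
begin

abbreviation "W \<equiv> wavelet_transform \<pi> \<eta>"

abbreviation "g \<equiv> g_fun \<pi> \<eta>"

definition "A = (SOME A. is_adjoint M W A \<and> (\<forall>\<psi>. A (W \<psi>) = \<psi>))"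

lemma adjoint:
  shows W_adjoint: "f \<in> L2 M \<Longrightarrow> L2_inner M (W \<psi>) f = cinner \<psi> (A f)"
    and A_W: "A (W \<psi>) = \<psi>"
proof -
  have "\<exists>A. is_adjoint M W A \<and> (\<forall>\<psi>. A (W \<psi>) = \<psi>)"
    using admissible by (simp add: admissible_def)
  from someI_ex[OF this] show "f \<in> L2 M \<Longrightarrow> L2_inner M (W \<psi>) f = cinner \<psi> (A f)" "A (W \<psi>) = \<psi>"
    unfolding A_def[symmetric] by (auto simp: is_adjoint_def)
qed

lemma W_L2: "W \<psi> \<in> L2 M"
  using admissible by (simp add: admissible_def)

lemma W_isometry: "L2_inner M (W \<psi>) (W \<phi>) = cinner \<psi> \<phi>"
  by (simp add: W_adjoint W_L2 A_W)

lemma norm_W: "L2_norm M (W \<psi>) = norm \<psi>"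
proof -
  have "complex_of_real ((L2_norm M (W \<psi>))\<^sup>2) = complex_of_real ((norm \<psi>)\<^sup>2)"
    using W_isometry[of \<psi> \<psi>] by (simp only: L2_inner_self cinner_self)
  then show ?thesis
    unfolding of_real_eq_iff by (simp add: power2_eq_iff_nonneg)
qed

lemma norm_A:
  assumes "f \<in> L2 M"
  shows "norm (A f) \<le> L2_norm M f"
proof -
  have "(norm (A f))\<^sup>2 = cmod (L2_inner M (W (A f)) f)"
    unfolding W_adjoint[OF assms] cinner_self norm_of_real by simp
  also have "\<dots> \<le> L2_norm M f * norm (A f)"
    using L2_Cauchy_Schwarz[OF W_L2[of "A f"] assms] unfolding norm_W by (simp add: mult.commute)
  finally show ?thesis
    by (rule power2_le_mult_imp_le) simp_all
qed

section \<open>Matrix coefficients and convolution with \<open>g\<close>\<close>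

lemma rep_unitary: "unitary_operator (\<pi> s)"
  using rep unfolding unitary_representation_def by blast

lemma rep_inner: "cinner (\<pi> s x) (\<pi> s y) = cinner x y"
  using rep_unitary unfolding unitary_operator_def by blast

lemma rep_add: "\<pi> (s + t) x = \<pi> s (\<pi> t x)"
  using rep by (simp add: unitary_representation_def)

lemma rep_0: "\<pi> 0 x = x"
proof -
  have "surj (\<pi> 0)" using rep_unitary unfolding unitary_operator_def by blast
  then obtain y where y: "x = \<pi> 0 y" by (rule surjE)
  show ?thesis unfolding y rep_add[symmetric] by simp
qed

lemma rep_shift: "cinner (\<pi> s x) y = cinner x (\<pi> (- s) y)"
proof -
  have "\<pi> s (\<pi> (- s) y) = y"
    unfolding rep_add[symmetric] by (simp add: rep_0)
  then show ?thesis using rep_inner[of s x "\<pi> (- s) y"] by simp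
qed

lemma continuous_W: "continuous_on UNIV (W \<psi>)"
  unfolding wavelet_transform_def
  using rep by (intro continuous_on_cinner) (simp add: unitary_representation_def)

lemma g_eq: "g = W \<eta>"
  by (simp add: g_fun_def wavelet_transform_def)

lemma g_L2: "g \<in> L2 M"
  by (simp add: g_eq W_L2)

lemma continuous_g: "continuous_on UNIV g"
  by (simp add: g_eq continuous_W)

lemma g_minus: "g (- s) = cnj (g s)"
  unfolding g_fun_def rep_shift[symmetric] by (rule cinner_commute)

lemma flat_g: "flat g = g"
  by (simp add: flat_def g_minus)

lemma cmod_g_minus: "cmod (g (- s)) = cmod (g s)"
  by (simp add: g_minus)

text \<open>By unitarity \<open>g (- t + s)\<close> is
  \<open>cinner (\<pi> t \<eta>) (\<pi> s \<eta>)\<close>, so the convolution at \<open>s\<close> is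
  the inner product of \<open>f\<close> with \<open>W (\<pi> s \<eta>)\<close>. Taking the adjoint
  gives equality at every point, and \<open>W (A f)\<close> is the projection of \<open>f\<close>
  onto the range of \<open>W\<close>.\<close>

lemma convolution_g:
  assumes "f \<in> L2 M"
  shows "convolution M f g = W (A f)"
proof
  fix s
  have "f t * g (- t + s) = f t * cnj (W (\<pi> s \<eta>) t)" for t
  proof -
    have "g (- t + s) = cinner (\<pi> t \<eta>) (\<pi> s \<eta>)"
      by (simp only: g_fun_def rep_add rep_shift)
    then show ?thesis
      using cinner_commute[of "\<pi> t \<eta>" "\<pi> s \<eta>"] by (simp add: wavelet_transform_def)
  qed
  then have "convolution M f g s = L2_inner M f (W (\<pi> s \<eta>))"
    by (simp only: convolution_def L2_inner_def)
  also have "\<dots> = cnj (cinner (\<pi> s \<eta>) (A f))"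
    unfolding W_adjoint[OF assms, symmetric] by (rule L2_inner_commute)
  also have "\<dots> = W (A f) s"
    using cinner_commute[of "A f" "\<pi> s \<eta>"] by (simp add: wavelet_transform_def)
  finally show "convolution M f g s = W (A f) s" .
qed

text \<open>Convolution with \<open>g\<close> is the contraction \<open>A\<close> followed by the
  isometry \<open>W\<close>, hence the constant 1.\<close>

lemma g_right_bounded: "g \<in> right_bounded M"
proof -
  have L2: "f \<in> L2 M" if f: "f \<in> compactly_supported" for f
  proof -
    have cont: "continuous_on UNIV f" and K: "compact (closure {s. f s \<noteq> 0})"
      using f by (simp_all add: compactly_supported_def)
    have "integrable M (\<lambda>x. (cmod (f x))\<^sup>2)"
    proof (rule integrable_compact_support[OF _ K])
      show "continuous_on UNIV (\<lambda>x. (cmod (f x))\<^sup>2)" by (intro continuous_intros cont)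
      show "(cmod (f x))\<^sup>2 = 0" if "x \<notin> closure {s. f s \<noteq> 0}" for x
        using that subsetD[OF closure_subset, of x "{s. f s \<noteq> 0}"] by auto
    qed
    then show ?thesis
      using continuous_measurable[OF cont] by (simp add: L2_def)
  qed
  have "\<forall>f\<in>compactly_supported. convolution M f g \<in> L2 M"
    by (simp add: L2 convolution_g W_L2)
  moreover have "\<forall>f\<in>compactly_supported. L2_norm M (convolution M f g) \<le> 1 * L2_norm M f"
    by (simp add: L2 convolution_g norm_W norm_A)
  ultimately show ?thesis
    unfolding right_bounded_def by (intro CollectI conjI exI[of _ 1] g_L2)
qed

text \<open>The modulus of \<open>g\<close> is invariant under inversion, so inverting its square
  only introduces the weight.\<close>

lemma integrable_inverse_delta_g: "integrable M (\<lambda>s. inverse (\<delta> s) * (cmod (g s))\<^sup>2)"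
proof -
  have "continuous_on UNIV (\<lambda>s. (cmod (g s))\<^sup>2)"
    by (intro continuous_intros continuous_g)
  from integrable_inverse[OF this L2_integrable[OF g_L2]] show ?thesis
    by (simp add: cmod_g_minus delta_minus)
qed

lemma g_right_hilbert_algebra: "g \<in> right_hilbert_algebra M \<delta>"
  by (simp add: right_hilbert_algebra_def flat_domain_def g_right_bounded g_L2 integrable_inverse_delta_g)

text \<open>\<open>g\<close> reproduces itself under convolution, since \<open>flat g = g\<close>
  and \<open>W (A (W \<eta>)) = W \<eta>\<close>; so it is one of the generators of the cone even
  before closing.\<close>

lemma g_flat_cone: "g \<in> flat_cone M \<delta>"
proof -
  have "g = convolution M g (flat g)"
    by (simp add: flat_g convolution_g g_L2) (simp add: g_eq A_W)
  then have "g \<in> (\<lambda>g. convolution M g (flat g)) ` right_hilbert_algebra M \<delta>"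
    using g_right_hilbert_algebra by (rule image_eqI)
  then show ?thesis
    unfolding flat_cone_def by (rule L2_closure_superset[OF _ g_L2])
qed

lemma continuous_modular_power:
  assumes "continuous_on UNIV f"
  shows "continuous_on UNIV (modular_power \<delta> a f)"
  unfolding modular_power_def
  by (intro continuous_intros assms delta_continuous continuous_on_powr) simp

text \<open>The exponent \<open>-1/4\<close> serves \<open>\<xi>\<close>, and \<open>-1/2\<close>
  serves J g. The square of either weight is at most
  \<open>1 + inverse (\<delta> s)\<close>.\<close>

lemma modular_power_g_L2:
  assumes "a = -1/4 \<or> a = -1/2"
  shows "modular_power \<delta> a g \<in> L2 M"
proof (rule L2_bound)
  show "modular_power \<delta> a g \<in> borel_measurable M"
    by (intro continuous_measurable continuous_modular_power continuous_g)
  show "integrable M (\<lambda>s. (cmod (g s))\<^sup>2 + inverse (\<delta> s) * (cmod (g s))\<^sup>2)"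
    by (intro Bochner_Integration.integrable_add L2_integrable g_L2 integrable_inverse_delta_g)
  fix s
  have "\<delta> s powr a * \<delta> s powr a \<le> 1 + inverse (\<delta> s)"
    using assms
  proof
    assume "a = -1/4"
    then show ?thesis using powr_minus_quarter_sq_le[OF delta_pos[of s]] by (simp only:)
  next
    assume "a = -1/2"
    then have "\<delta> s powr a * \<delta> s powr a = \<delta> s powr (-1)"
      by (simp only: powr_add[symmetric]) simp
    then show ?thesis by (simp add: powr_minus)
  qed
  then have "\<delta> s powr a * \<delta> s powr a * (cmod (g s))\<^sup>2 \<le> (1 + inverse (\<delta> s)) * (cmod (g s))\<^sup>2"
    by (rule mult_right_mono) simp
  then show "(cmod (modular_power \<delta> a g s))\<^sup>2 \<le> (cmod (g s))\<^sup>2 + inverse (\<delta> s) * (cmod (g s))\<^sup>2"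
    by (simp add: modular_power_def norm_mult power_mult_distrib power2_eq_square algebra_simps)
qed

abbreviation "\<xi> \<equiv> modular_power \<delta> (-1/4) g"

lemma xi_L2: "\<xi> \<in> L2 M"
  by (rule modular_power_g_L2) simp

lemma xi_self_dual_cone: "\<xi> \<in> self_dual_cone M \<delta>"
  unfolding self_dual_cone_def
  by (intro L2_closure_superset xi_L2 imageI IntI g_flat_cone)
    (use g_L2 xi_L2 in \<open>simp add: modular_power_domain_def\<close>)

lemma xi_H_hat: "\<xi> \<in> H_hat M \<delta> \<pi> \<eta>"
  unfolding H_hat_def L2_closed_span_def
proof (rule L2_closure_superset[OF _ xi_L2])
  have "\<xi> \<in> {T \<xi> | T. T \<in> left_group_algebra M}"
    using id_left_group_algebra by (intro CollectI exI[of _ "\<lambda>f. f"]) simp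
  then show "\<xi> \<in> {(\<lambda>x. \<Sum>f\<in>F. c f * f x) | F c. finite F \<and> F \<subseteq> {T \<xi> | T. T \<in> left_group_algebra M}}"
    by (intro CollectI exI[of _ "{\<xi>}"] exI[of _ "\<lambda>_. 1"]) auto
qed

end

section \<open>Orthogonality to the whole orbit\<close>

context haar_group begin

text \<open>Here \<open>u\<close> is \<open>R\<^sub>2 (J g\<^sub>1)\<close> and \<open>v\<close> is \<open>R\<^sub>1 (J g\<^sub>2)\<close>, so that \<open>uv\<close> says \<open>J u = v\<close>.\<close>

lemma orthogonal_orbit:
  assumes "wavelet M \<delta> \<pi>1 \<eta>1" and "wavelet M \<delta> \<pi>2 \<eta>2"
    and orth: "L2_inner M (modular_power \<delta> (-1/4) (g_fun \<pi>1 \<eta>1)) (modular_power \<delta> (-1/4) (g_fun \<pi>2 \<eta>2)) = 0"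
  shows "L2_inner M (modular_power \<delta> (-1/4) (g_fun \<pi>1 \<eta>1))
    (left_regular s (modular_power \<delta> (-1/4) (g_fun \<pi>2 \<eta>2))) = 0"
proof -
  interpret w1: wavelet M \<delta> \<pi>1 \<eta>1 by fact
  interpret w2: wavelet M \<delta> \<pi>2 \<eta>2 by fact
  let ?d = "\<lambda>a s. complex_of_real (\<delta> s powr a)"
  let ?J1 = "modular_power \<delta> (-1/2) w1.g" and ?J2 = "modular_power \<delta> (-1/2) w2.g"
  have J1: "?J1 \<in> L2 M" by (rule w1.modular_power_g_L2) simp
  have J2: "?J2 \<in> L2 M" by (rule w2.modular_power_g_L2) simp
  have quarter: "?d (-1/2) s = ?d (-1/4) s * ?d (-1/4) s" for s
    by (simp add: of_real_mult[symmetric] powr_add[symmetric] del: of_real_mult)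
  define u where "u = w2.W (w2.A ?J1)"
  define v where "v = w1.W (w1.A ?J2)"
  have u: "u s = (\<integral>t. ?J1 t * w2.g (- t + s) \<partial>M)" for s
    unfolding u_def w2.convolution_g[OF J1, symmetric] convolution_def ..
  have v: "v s = (\<integral>t. ?J2 t * w1.g (- t + s) \<partial>M)" for s
    unfolding v_def w1.convolution_g[OF J2, symmetric] convolution_def ..
  have uv: "u (- s) = ?d (1/2) s * cnj (v s)" for s
  proof -
    have "continuous_on UNIV (\<lambda>t. ?J1 t * w2.g (- t + - s))"
      by (intro continuous_intros w1.continuous_modular_power w1.continuous_g
          continuous_on_compose2[OF w2.continuous_g]) auto
    \<comment> \<open>Substituting \<open>- s + t\<close> for \<open>t\<close> turns the second
      factor into \<open>w2.g (- t)\<close>; the symmetry of both functions under inversion then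
      exchanges the roles of the two vectors.\<close>
    from integral_left[OF continuous_measurable[OF this], of "- s"]
    have "u (- s) = (\<integral>t. ?J1 (- s + t) * w2.g (- (- s + t) + - s) \<partial>M)"
      unfolding u by simp
    also have "\<dots> = (\<integral>t. ?d (1/2) s * cnj (?J2 t * w1.g (- t + s)) \<partial>M)"
    proof (rule Bochner_Integration.integral_cong[OF refl])
      fix t
      have "- (- s + t) + - s = - t" by (simp only: minus_add minus_minus add.assoc right_minus add_0_right)
      moreover have "w1.g (- s + t) = cnj (w1.g (- t + s))"
        using w1.g_minus[of "- t + s"] by (simp only: minus_add minus_minus)
      ultimately show "?J1 (- s + t) * w2.g (- (- s + t) + - s) = ?d (1/2) s * cnj (?J2 t * w1.g (- t + s))"
        by (simp only: modular_power_def w2.g_minus delta_powr_add delta_powr_minus) simp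
    qed
    also have "\<dots> = ?d (1/2) s * cnj (v s)"
      by (simp only: v integral_mult_right_zero Bochner_Integration.integral_cnj)
    finally show ?thesis .
  qed
  have "complex_of_real ((norm (w2.A ?J1))\<^sup>2) = L2_inner M u ?J1"
    unfolding u_def w2.W_adjoint[OF J1] cinner_self ..
  also have "\<dots> = (\<integral>s. u s * cnj (?J1 s) \<partial>M)"
    by (rule L2_inner_def)
  also have "\<dots> = (\<integral>s. complex_of_real (\<delta> (- s)) * (u (- s) * cnj (?J1 (- s))) \<partial>M)"
    unfolding u_def
    by (intro integral_inverse[symmetric] continuous_intros w2.continuous_W
        w1.continuous_modular_power w1.continuous_g L2_inner_integrable w2.W_L2 J1)
  also have "\<dots> = (\<integral>s. w1.g s * cnj (v s) \<partial>M)"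
  proof (rule Bochner_Integration.integral_cong[OF refl])
    fix s
    \<comment> \<open>Inversion contributes \<open>\<delta> (- s)\<close>, while
      \<open>u (- s)\<close> and \<open>?J1 (- s)\<close> each contribute a square root of
      \<open>\<delta> s\<close>. That these cancel is the antiunitarity of J.\<close>
    have "\<delta> (- s) * \<delta> s powr (1/2) * \<delta> s powr (1/2) = 1"
      by (simp add: powr_add[symmetric] delta_minus mult.assoc)
    then have one: "complex_of_real (\<delta> (- s)) * ?d (1/2) s * ?d (1/2) s = 1"
      by (simp only: of_real_mult[symmetric] of_real_1)
    have "cnj (?J1 (- s)) = ?d (1/2) s * w1.g s"
      by (simp add: modular_power_def w1.g_minus delta_powr_minus)
    then have "complex_of_real (\<delta> (- s)) * (u (- s) * cnj (?J1 (- s))) =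
        (complex_of_real (\<delta> (- s)) * ?d (1/2) s * ?d (1/2) s) * (w1.g s * cnj (v s))"
      by (simp only: uv ac_simps)
    then show "complex_of_real (\<delta> (- s)) * (u (- s) * cnj (?J1 (- s))) = w1.g s * cnj (v s)"
      by (simp only: one mult_1_left)
  qed
  also have "\<dots> = L2_inner M (w1.W \<eta>1) v"
    by (simp add: L2_inner_def w1.g_eq)
  also have "\<dots> = L2_inner M w1.g ?J2"
    unfolding v_def w1.W_isometry w1.W_adjoint[OF J2, symmetric] w1.g_eq ..
  \<comment> \<open>The weight \<open>-1/2\<close> on the second factor is split evenly between the
    two.\<close>
  also have "\<dots> = L2_inner M w1.\<xi> w2.\<xi>"
    unfolding L2_inner_def
    by (intro Bochner_Integration.integral_cong refl)
      (simp only: modular_power_def quarter complex_cnj_mult complex_cnj_complex_of_real ac_simps)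
  \<comment> \<open>The vector itself is zero, so \<open>u\<close> vanishes at every point and not
    just almost everywhere.\<close>
  finally have "w2.A ?J1 = 0" using orth by simp
  then have u0: "u s = 0" by (simp add: u_def wavelet_transform_def)
  \<comment> \<open>Translation by \<open>s\<close> changes the weight only by a constant factor;
    the rest of the integrand is that of \<open>u s\<close>.\<close>
  have "L2_inner M w1.\<xi> (left_regular s w2.\<xi>) = (\<integral>t. ?d (-1/4) (- s) * (?J1 t * w2.g (- t + s)) \<partial>M)"
    unfolding L2_inner_def
  proof (rule Bochner_Integration.integral_cong[OF refl])
    fix t
    have "cnj (w2.g (- s + t)) = w2.g (- t + s)"
      using w2.g_minus[of "- s + t"] by (simp only: minus_add minus_minus)
    then show "w1.\<xi> t * cnj (left_regular s w2.\<xi> t) = ?d (-1/4) (- s) * (?J1 t * w2.g (- t + s))"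
      by (simp only: left_regular_def modular_power_def delta_powr_add quarter of_real_mult
          complex_cnj_mult complex_cnj_complex_of_real ac_simps)
  qed
  also have "\<dots> = ?d (-1/4) (- s) * u s"
    unfolding u by simp
  finally show ?thesis using u0 by simp
qed

end

theorem theorem18:
  fixes M :: "'a::locally_compact_group measure"
    and \<delta> :: "'a \<Rightarrow> real"
    and \<pi>1 :: "'a \<Rightarrow> 'h1::complex_hilbert_space \<Rightarrow> 'h1"
    and \<pi>2 :: "'a \<Rightarrow> 'h2::complex_hilbert_space \<Rightarrow> 'h2"
    and \<eta>1 :: 'h1 and \<eta>2 :: 'h2
  assumes "left_haar_measure M" and "modular_function M \<delta>"
    and "unitary_representation \<pi>1" and "admissible M \<pi>1 \<eta>1"
    and "unitary_representation \<pi>2" and "admissible M \<pi>2 \<eta>2"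
  shows "(L2_inner M (modular_power \<delta> (-1/4) (g_fun \<pi>1 \<eta>1))
                     (modular_power \<delta> (-1/4) (g_fun \<pi>2 \<eta>2)) = 0
            \<longleftrightarrow> L2_orthogonal M (P_hat M \<delta> \<pi>1 \<eta>1) (P_hat M \<delta> \<pi>2 \<eta>2)) \<and>
         (L2_orthogonal M (P_hat M \<delta> \<pi>1 \<eta>1) (P_hat M \<delta> \<pi>2 \<eta>2)
            \<longleftrightarrow> L2_orthogonal M (H_hat M \<delta> \<pi>1 \<eta>1) (H_hat M \<delta> \<pi>2 \<eta>2))"
proof -
  interpret w1: wavelet M \<delta> \<pi>1 \<eta>1
    using assms by (simp add: wavelet_def haar_group_def wavelet_axioms_def)
  interpret w2: wavelet M \<delta> \<pi>2 \<eta>2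
    using assms by (simp add: wavelet_def haar_group_def wavelet_axioms_def)
  let ?H1 = "{T w1.\<xi> | T. T \<in> left_group_algebra M}" and ?H2 = "{T w2.\<xi> | T. T \<in> left_group_algebra M}"
  have sub1: "?H1 \<subseteq> L2 M" and sub2: "?H2 \<subseteq> L2 M"
    using w1.left_group_algebra_L2[OF _ w1.xi_L2] w1.left_group_algebra_L2[OF _ w2.xi_L2] by blast+
  have "L2_orthogonal M (H_hat M \<delta> \<pi>1 \<eta>1) (H_hat M \<delta> \<pi>2 \<eta>2)" if orth: "L2_inner M w1.\<xi> w2.\<xi> = 0"
  proof -
    have base: "L2_inner M f h = 0" if fh: "f \<in> ?H1" "h \<in> ?H2" for f h
    proof -
      obtain T S where T: "f = T w1.\<xi>" "T \<in> left_group_algebra M"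
        and S: "h = S w2.\<xi>" "S \<in> left_group_algebra M"
        using fh by blast
      show ?thesis
        unfolding T(1) S(1)
        by (rule w1.left_group_algebra_orthogonal[OF w1.xi_L2 w2.xi_L2 _ T(2) S(2)])
          (rule w1.orthogonal_orbit[OF w1.wavelet_axioms w2.wavelet_axioms orth])
    qed
    \<comment> \<open>The closed span is taken in one argument at a time: \<open>h\<close> is still
      a generator here, and the second passage uses conjugate symmetry.\<close>
    have left: "L2_inner M f h = 0" if "f \<in> H_hat M \<delta> \<pi>1 \<eta>1" "h \<in> ?H2" for f h
    proof (rule L2_orthogonal_closed_span[OF sub1])
      show "h \<in> L2 M" using that(2) sub2 by blast
      show "f \<in> L2_closed_span M ?H1" using that(1) by (simp only: H_hat_def)
      show "L2_inner M k h = 0" if "k \<in> ?H1" for k using base[OF that \<open>h \<in> ?H2\<close>] .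
    qed
    show ?thesis
      unfolding L2_orthogonal_def
    proof (intro ballI)
      fix f h assume f: "f \<in> H_hat M \<delta> \<pi>1 \<eta>1" and h: "h \<in> H_hat M \<delta> \<pi>2 \<eta>2"
      have "f \<in> L2 M" using f by (simp add: H_hat_def L2_closed_span_def L2_closure_def)
      moreover have "L2_inner M k f = 0" if "k \<in> ?H2" for k
        using left[OF f that] L2_inner_commute[of M k f] by simp
      moreover have "h \<in> L2_closed_span M ?H2" using h by (simp only: H_hat_def)
      ultimately have "L2_inner M h f = 0"
        by (rule L2_orthogonal_closed_span[OF sub2])
      then show "L2_inner M f h = 0" using L2_inner_commute[of M f h] by simp
    qed
  qed
  moreover have "L2_orthogonal M (P_hat M \<delta> \<pi>1 \<eta>1) (P_hat M \<delta> \<pi>2 \<eta>2)"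
    if "L2_orthogonal M (H_hat M \<delta> \<pi>1 \<eta>1) (H_hat M \<delta> \<pi>2 \<eta>2)"
    using that by (auto simp: L2_orthogonal_def P_hat_def)
  moreover have "L2_inner M w1.\<xi> w2.\<xi> = 0"
    if "L2_orthogonal M (P_hat M \<delta> \<pi>1 \<eta>1) (P_hat M \<delta> \<pi>2 \<eta>2)"
    using that w1.xi_self_dual_cone w1.xi_H_hat w2.xi_self_dual_cone w2.xi_H_hat
    by (auto simp: L2_orthogonal_def P_hat_def)
  ultimately show ?thesis by blast
qed

end
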